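(* Let $\mathbb{X}$ be a Banach space, $r_0\in(0,+\infty]$ and $I\subset\mathbb{R}$ an interval. Let $(V_t)_{t\in I}$ be a normal family of analytic vector fields in $\mathbb{F}_{r_0}(\mathbb{X},\mathbb{X})$ and let $X=\sum_{k=0}^\infty X_kz^k\in\mathbb{F}_{r_0}(\mathbb{R})$ be such that $0\le\|V_t^{(p)}\|_\otimes\le X_p$ for all $t\in I$, $p\in\mathbb{N}$. Assume that the map $I\times B_{\mathbb{X}}(r_0)\ni(t,\varphi)\mapsto V_t(\varphi)\in\mathbb{X}$ is continuous. Let $R,\overline R\in\mathbb{R}$ with $0<R<\overline R<r_0$ and let $f\in\mathbb{F}_{\overline R}(\mathbb{X})$. Let $t_1,t_2\in I$ be such that $e^{-|t_2-t_1|X}(R)>0$ and let $\varphi\in\mathcal{C}^1([t_1,t_2],\mathbb{X})$ be such that $\|\varphi(t)\|_{\mathbb{X}}\le e^{-|t-t_1|X}(R)$ for all $t\in[t_1,t_2]$. Set $U_{t_1}^t:=T\exp\left(\int_{t_1}^td\tau\,V_\tau\cdot\right)$. Then the map $$[t_1,t_2]\to\mathbb{R},\qquad t\mapsto(U_{t_1}^tf)(\varphi(t))$$ is $\mathcal{C}^1$ and satisfies $$\frac{d}{dt}\left((U_{t_1}^tf)(\varphi(t))\right)=(V_t\cdot U_{t_1}^tf)(\varphi(t))+\delta(U_{t_1}^tf)_{\varphi(t)}\left(\frac{d\varphi(t)}{dt}\right).$$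
   Context: For Banach spaces $\mathbb{X},\mathbb{Y}$, $B_{\mathbb{X}}(\rho)$ is the open ball of radius $\rho$ centred at $0$; $\mathcal{Q}^p(\mathbb{X},\mathbb{Y})$ is the space of homogeneous polynomial maps $f(\varphi)=f_\otimes(\varphi\otimes\cdots\otimes\varphi)$ of degree $p$, where $f_\otimes:\mathbb{X}^{\otimes p}\to\mathbb{Y}$ is symmetric linear; $\|f\|_\otimes$ is the smallest constant such that $\|f_\otimes(\varphi_1\otimes\cdots\otimes\varphi_p)\|_{\mathbb{Y}}\le\|f\|_\otimes\|\varphi_1\|\cdots\|\varphi_p\|$. A formal series is $f=\sum_{p\ge0}f^{(p)}$ with $f^{(p)}\in\mathcal{Q}^p(\mathbb{X},\mathbb{Y})$, and $[\![f]\!](z)=\sum_p\|f^{(p)}\|_\otimes z^p$. For $r\in(0,\infty)$, $\mathbb{F}_r(\mathbb{X},\mathbb{Y})$ is the Banach space of formal series with $[\![f]\!](r)<+\infty$, normed by $[\![f]\!](r)$; $\mathbb{F}_\infty=\bigcap_{r>0}\mathbb{F}_r$; $\mathbb{F}_r(\mathbb{X}):=\mathbb{F}_r(\mathbb{X},\mathbb{R})$. Elements of $\mathbb{F}_r(\mathbb{X},\mathbb{X})$ are called analytic vector fields. A family $(V_t)$ is normal if there is a power series $\sum_pX^{(p)}z^p$ (with the given radius of convergence) with $\|V_t^{(p)}\|_\otimes\le X^{(p)}$ for all $t,p$. For an analytic vector field $V$, $(V\cdot f)(\varphi)=\delta f_\varphi(V(\varphi))$ with $\delta f_\varphi$ the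 differential of $f$ at $\varphi$. $\gamma(t)=e^{-tX}(z)$ is the solution of $\gamma'(t)=-X(\gamma(t))$, $\gamma(0)=z$. The chronological exponential is $$T\exp\int_{t_1}^{t_2}d\tau V_\tau\cdot=\sum_{k\ge0}\int_{t_1<\tau_1<\cdots<\tau_k<t_2}(V_{\tau_k}\cdot)\cdots(V_{\tau_1}\cdot)\,d\tau_1\cdots d\tau_k\quad(t_2>t_1),$$ and $\sum_{k\ge0}(-1)^k\int_{t_2<\tau_k<\cdots<\tau_1<t_1}(V_{\tau_k}\cdot)\cdots(V_{\tau_1}\cdot)\,d\tau_1\cdots d\tau_k$ for $t_2<t_1$, the $k=0$ term being the identity. $[t_1,t_2]$ denotes the closed interval with endpoints $t_1,t_2$. *)

theory Defs
  imports "HOL-Analysis.Analysis"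
begin

(* A linear map on the p-th tensor power is represented by the corresponding p-linear map,
   taken as a function on lists; only its values on lists of length p matter. *)
definition sym_multilinear :: "nat \<Rightarrow> ('a::real_vector list \<Rightarrow> 'b::real_vector) \<Rightarrow> bool" where
  "sym_multilinear p F \<longleftrightarrow>
     (\<forall>xs i. length xs = p \<longrightarrow> i < p \<longrightarrow> linear (\<lambda>x. F (xs[i := x]))) \<and>
     (\<forall>xs ys. length xs = p \<longrightarrow> mset xs = mset ys \<longrightarrow> F xs = F ys)"

definition tensor_bound ::
    "nat \<Rightarrow> ('a::real_normed_vector list \<Rightarrow> 'b::real_normed_vector) \<Rightarrow> real \<Rightarrow> bool" where
  "tensor_bound p F C \<longleftrightarrow> 0 \<le> C \<and>
     (\<forall>xs. length xs = p \<longrightarrow> norm (F xs) \<le> C * prod_list (map norm xs))"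

definition is_tensor_form :: "nat \<Rightarrow> ('a::real_vector \<Rightarrow> 'b::real_vector) \<Rightarrow> ('a list \<Rightarrow> 'b) \<Rightarrow> bool" where
  "is_tensor_form p f F \<longleftrightarrow> sym_multilinear p F \<and> (\<forall>x. f x = F (replicate p x))"

definition hom_poly :: "nat \<Rightarrow> ('a::real_normed_vector \<Rightarrow> 'b::real_normed_vector) set" where
  "hom_poly p = {f. \<exists>F C. is_tensor_form p f F \<and> tensor_bound p F C}"

(* By polarization the form F is determined by f on lists of length p. *)
definition tensor_norm :: "nat \<Rightarrow> ('a::real_normed_vector \<Rightarrow> 'b::real_normed_vector) \<Rightarrow> real" where
  "tensor_norm p f = Inf {C. \<exists>F. is_tensor_form p f F \<and> tensor_bound p F C}"

definition series_space ::
    "real \<Rightarrow> (nat \<Rightarrow> 'a::real_normed_vector \<Rightarrow> 'b::real_normed_vector) set" where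
  "series_space r =
     {f. (\<forall>p. f p \<in> hom_poly p) \<and> summable (\<lambda>p. tensor_norm p (f p) * r ^ p)}"

definition ext_series_space ::
    "ereal \<Rightarrow> (nat \<Rightarrow> 'a::real_normed_vector \<Rightarrow> 'b::real_normed_vector) set" where
  "ext_series_space r =
     (if r = \<infinity> then (\<Inter>s\<in>{0<..}. series_space s) else series_space (real_of_ereal r))"

definition series_eval :: "(nat \<Rightarrow> 'a \<Rightarrow> 'b::real_normed_vector) \<Rightarrow> 'a \<Rightarrow> 'b" where
  "series_eval f x = (\<Sum>p. f p x)"

definition power_series :: "(nat \<Rightarrow> real) \<Rightarrow> nat \<Rightarrow> real \<Rightarrow> real" where
  "power_series a p z = a p * z ^ p"

definition normal_family ::
    "ereal \<Rightarrow> real set \<Rightarrow> (real \<Rightarrow> nat \<Rightarrow> 'a::real_normed_vector \<Rightarrow> 'a) \<Rightarrow> bool" where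
  "normal_family r I V \<longleftrightarrow>
     (\<exists>a. power_series a \<in> ext_series_space r \<and> (\<forall>t\<in>I. \<forall>p. tensor_norm p (V t p) \<le> a p))"

definition ext_ball :: "ereal \<Rightarrow> 'a::real_normed_vector set" where
  "ext_ball r = {x. ereal (norm x) < r}"

(* gamma s = e^(-sX)(z) for 0 <= s <= T; in particular the solution exists up to time T. *)
definition backward_flow ::
    "ereal \<Rightarrow> (real \<Rightarrow> real) \<Rightarrow> real \<Rightarrow> real \<Rightarrow> (real \<Rightarrow> real) \<Rightarrow> bool" where
  "backward_flow r X z T \<gamma> \<longleftrightarrow> \<gamma> 0 = z \<and>
     (\<forall>s\<in>{0..T}. \<gamma> s \<in> ext_ball r \<and>
        (\<gamma> has_real_derivative - X (\<gamma> s)) (at s within {0..T}))"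

definition lie :: "('a::real_normed_vector \<Rightarrow> 'a) \<Rightarrow> ('a \<Rightarrow> real) \<Rightarrow> 'a \<Rightarrow> real" where
  "lie v g x = frechet_derivative g (at x) (v x)"

primrec lie_iter ::
    "(real \<Rightarrow> 'a::real_normed_vector \<Rightarrow> 'a) \<Rightarrow> (nat \<Rightarrow> real) \<Rightarrow> nat \<Rightarrow> ('a \<Rightarrow> real) \<Rightarrow> 'a \<Rightarrow> real" where
  "lie_iter v \<tau> 0 g = g"
| "lie_iter v \<tau> (Suc k) g = lie (v (\<tau> (Suc k))) (lie_iter v \<tau> k g)"

definition time_simplex :: "nat \<Rightarrow> real \<Rightarrow> real \<Rightarrow> (nat \<Rightarrow> real) set" where
  "time_simplex k s t =
     (if s \<le> t then {\<tau>. \<tau> ` {1..k} \<subseteq> {s<..<t} \<and> strict_mono_on {1..k} \<tau>}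
      else {\<tau>. \<tau> ` {1..k} \<subseteq> {t<..<s} \<and> strict_antimono_on {1..k} \<tau>})"

definition chron_term ::
    "(real \<Rightarrow> 'a::real_normed_vector \<Rightarrow> 'a) \<Rightarrow> real \<Rightarrow> real \<Rightarrow> ('a \<Rightarrow> real) \<Rightarrow> 'a \<Rightarrow> nat \<Rightarrow> real" where
  "chron_term v s t g x k = (if s \<le> t then 1 else (- 1) ^ k) *
     (LINT \<tau>:time_simplex k s t | Pi\<^sub>M {1..k} (\<lambda>_. lborel). lie_iter v \<tau> k g x)"

(* Integrals and sum are taken pointwise in x: joint continuity of v in (t, x) does not make the
   iterated operators continuous in time for the norm of a space of series. *)
definition chron_exp ::
    "(real \<Rightarrow> 'a::real_normed_vector \<Rightarrow> 'a) \<Rightarrow> real \<Rightarrow> real \<Rightarrow> ('a \<Rightarrow> real) \<Rightarrow> 'a \<Rightarrow> real" where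
  "chron_exp v s t g x = (\<Sum>k. chron_term v s t g x k)"

definition chron_exp_converges ::
    "(real \<Rightarrow> 'a::real_normed_vector \<Rightarrow> 'a) \<Rightarrow> real \<Rightarrow> real \<Rightarrow> ('a \<Rightarrow> real) \<Rightarrow> 'a \<Rightarrow> bool" where
  "chron_exp_converges v s t g x \<longleftrightarrow>
     (\<forall>k. set_integrable (Pi\<^sub>M {1..k} (\<lambda>_. lborel)) (time_simplex k s t) (\<lambda>\<tau>. lie_iter v \<tau> k g x)) \<and>
     summable (chron_term v s t g x)"

(* Derivatives are one-sided at the end points of an interval S. *)
definition has_C1_derivative_on ::
    "(real \<Rightarrow> 'a::real_normed_vector) \<Rightarrow> (real \<Rightarrow> 'a) \<Rightarrow> real set \<Rightarrow> bool" where
  "has_C1_derivative_on g g' S \<longleftrightarrow>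
     (\<forall>t\<in>S. (g has_vector_derivative g' t) (at t within S)) \<and> continuous_on S g'"

end

theory Submission
  imports Defs
begin

text \<open>
  The iterated Lie derivatives have to be controlled to all orders at once, since each further
  iterate differentiates the previous one.  This is done by majorants.  A function given by a series
  of multilinear forms of norms at most \<open>m p\<close> is majorized by the scalar power series \<open>m\<close>, and if a
  vector field is majorized by \<open>Y\<close>, then its Lie derivative of the function is majorized by
  \<open>Y m'\<close> (\<open>majorized_lie\<close>).  Hence, whatever the times, the \<open>k\<close>-fold iterate is majorized by
  \<open>(Y d/dz)\<^sup>k m\<close>, and integration over a simplex of volume \<open>\<bar>t - s\<bar>\<^sup>k / k!\<close> multiplies this majorant by
  that volume.

  These products are the Taylor coefficients of \<open>m\<close> along the flow of \<open>Y\<close>.  All derivatives of \<open>m\<close>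
  along an orbit are nonnegative, so a single Taylor term is at most the value of \<open>m\<close> at the end of the
  orbit, which stays bounded as long as the orbit stays in the disc of convergence.  The argument needs
  only a supersolution \<open>\<zeta>\<close> of the flow equation (\<open>supersolution_taylor_bound\<close>).  Since \<open>R\<close> is strictly
  smaller than \<open>Rbar\<close>, there is a supersolution that stays a fixed distance above \<open>\<gamma>\<close>, even
  for \<open>\<lambda> Y\<close> with some \<open>\<lambda> > 1\<close> and for a \<open>Y\<close> with coefficients strictly larger than those of \<open>X\<close>.
  The factor \<open>\<lambda>\<close> turns boundedness of the terms into a geometric decay that is uniform in time
  (\<open>perturbed_flow_geometric_bound\<close>).

  Below the level of iterates only three consequences of a majorant are used: bounds for the value, for
  the first derivative and for the second order remainder, each by values of the majorant
  (\<open>cauchy_estimates\<close>).  These survive integration in time even though the iterates depend on time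
  only pointwise continuously.  They also yield that the derivative in space is jointly continuous in
  time, point and direction, because it is a locally uniform limit of difference quotients
  (\<open>cauchy_estimates_parametric_continuous\<close>); this gives measurability of the integrands and continuity
  of the derivatives.

  By Fubini's theorem on the simplex, the term of order \<open>k + 1\<close> is the integral over time of the Lie
  derivative of the term of order \<open>k\<close> (\<open>term_at_Suc\<close>).  Each term is therefore continuously
  differentiable along the curve, and the time derivatives sum, after a shift of the index, to the Lie
  derivative of the chronological exponential.  The geometric bounds permit differentiation term by
  term (\<open>chron_exp_along_curve_C1\<close>).
\<close>

section \<open>Multilinear forms and their derivatives on the diagonal\<close>

text \<open>
  The forms range over all multilinear ones, because inserting a symmetric form into one slot of another
  destroys symmetry; the restriction to the diagonal is the same as that of the symmetrized form.
\<close>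
definition bounded_multilinear ::
    "nat \<Rightarrow> ('a::real_normed_vector list \<Rightarrow> 'b::real_normed_vector) \<Rightarrow> real \<Rightarrow> bool" where
  "bounded_multilinear p F C \<longleftrightarrow>
     (\<forall>us ws. length us + length ws + 1 = p \<longrightarrow> linear (\<lambda>x. F (us @ x # ws))) \<and>
     tensor_bound p F C"

text \<open>
  The differential at \<open>x\<close>, in direction \<open>y\<close>, of the restriction of a form of order \<open>p + 1\<close> to the
  diagonal.
\<close>
definition poly_deriv ::
    "('a list \<Rightarrow> 'b::comm_monoid_add) \<Rightarrow> nat \<Rightarrow> 'a \<Rightarrow> 'a \<Rightarrow> 'b" where
  "poly_deriv F p x y = (\<Sum>i\<le>p. F (replicate i x @ y # replicate (p - i) x))"

lemma bounded_multilinear_norm_le: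
  assumes "bounded_multilinear p F C" "length xs = p"
  shows "norm (F xs) \<le> C * prod_list (map norm xs)"
  using assms by (auto simp: bounded_multilinear_def tensor_bound_def)

lemma bounded_multilinear_nonneg: "bounded_multilinear p F C \<Longrightarrow> 0 \<le> C"
  by (auto simp: bounded_multilinear_def tensor_bound_def)

lemma bounded_multilinear_linear:
  "bounded_multilinear p F C \<Longrightarrow> length us + length ws + 1 = p \<Longrightarrow> linear (\<lambda>x. F (us @ x # ws))"
  by (auto simp: bounded_multilinear_def)

lemma bounded_multilinear_linear_hd:
  "bounded_multilinear (Suc p) F C \<Longrightarrow> length ws = p \<Longrightarrow> linear (\<lambda>x. F (x # ws))"
  using bounded_multilinear_linear[of "Suc p" F C "[]" ws] by simp

lemma bounded_multilinear_Cons: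
  assumes "bounded_multilinear (Suc p) F C"
  shows "bounded_multilinear p (\<lambda>xs. F (x # xs)) (C * norm x)"
  unfolding bounded_multilinear_def tensor_bound_def
proof (intro conjI allI impI)
  fix us ws :: "'a list" assume "length us + length ws + 1 = p"
  then show "linear (\<lambda>y. F (x # us @ y # ws))"
    using bounded_multilinear_linear[OF assms, of "x # us" ws] by simp
next
  show "0 \<le> C * norm x" using bounded_multilinear_nonneg[OF assms] by simp
next
  fix xs :: "'a list" assume "length xs = p"
  then show "norm (F (x # xs)) \<le> C * norm x * prod_list (map norm xs)"
    using bounded_multilinear_norm_le[OF assms, of "x # xs"] by (simp add: mult.assoc)
qed

lemma bounded_multilinear_replicate_le:
  assumes "bounded_multilinear p F C"
  shows "norm (F (replicate p x)) \<le> C * norm x ^ p"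
  using bounded_multilinear_norm_le[OF assms, of "replicate p x"]
  by (simp add: map_replicate prod_list_replicate)

lemma poly_deriv_Suc:
  "poly_deriv F (Suc p) x y = F (y # replicate (Suc p) x) + poly_deriv (\<lambda>xs. F (x # xs)) p x y"
  unfolding poly_deriv_def by (simp add: sum.atMost_Suc_shift del: sum.atMost_Suc)

lemma poly_deriv_linear:
  assumes "bounded_multilinear (Suc p) F C"
  shows "linear (poly_deriv F p x)"
proof -
  have "linear (\<lambda>y. \<Sum>i\<le>p. F (replicate i x @ y # replicate (p - i) x))"
    by (intro linear_compose_sum ballI bounded_multilinear_linear[OF assms]) auto
  then show ?thesis unfolding poly_deriv_def .
qed

text \<open>
  Bounds in terms of a larger radius \<open>norm x + d\<close>, rather than of powers of \<open>norm x\<close> with binomial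
  factors, reproduce themselves exactly when one argument is split off, so induction on the order
  suffices here and in the next two lemmas; and summation over the orders gives values of the scalar
  majorant itself instead of its derivatives.
\<close>
lemma multilinear_increment_le:
  assumes "bounded_multilinear p F C" "0 < d" "norm y \<le> d"
  shows "norm (F (replicate p (x + y)) - F (replicate p x)) \<le> C * (norm y / d) * (norm x + d) ^ p"
  using assms(1)
proof (induction p arbitrary: F C)
  case 0
  then show ?case using bounded_multilinear_nonneg[OF 0] assms by simp
next
  case (Suc p)
  note C = bounded_multilinear_nonneg[OF Suc.prems]
  let ?a = "norm x" and ?b = "norm y" and ?X = "replicate p x" and ?Z = "replicate p (x + y)"
  have add: "F ((x + y) # ?Z) = F (x # ?Z) + F (y # ?Z)"
    by (rule linear_add[OF bounded_multilinear_linear_hd[OF Suc.prems]]) simp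
  have "norm (F (y # ?Z)) \<le> C * ?b * norm (x + y) ^ p"
    using bounded_multilinear_replicate_le[OF bounded_multilinear_Cons[OF Suc.prems, of y], of "x + y"] .
  also have "\<dots> \<le> C * ?b * (?a + d) ^ p"
    using C assms(3) by (intro mult_left_mono power_mono norm_triangle_le) auto
  finally have 1: "norm (F (y # ?Z)) \<le> C * (?b / d) * (?a + d) ^ p * d"
    using assms(2) by (simp add: field_simps)
  have 2: "norm (F (x # ?Z) - F (x # ?X)) \<le> C * ?a * (?b / d) * (?a + d) ^ p"
    using Suc.IH[OF bounded_multilinear_Cons[OF Suc.prems, of x]] .
  have "norm (F (replicate (Suc p) (x + y)) - F (replicate (Suc p) x))
      = norm (F (y # ?Z) + (F (x # ?Z) - F (x # ?X)))"
    by (simp add: add algebra_simps)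
  also have "\<dots> \<le> C * (?b / d) * (?a + d) ^ p * d + C * ?a * (?b / d) * (?a + d) ^ p"
    by (rule norm_triangle_le[OF add_mono[OF 1 2]])
  also have "\<dots> = C * (?b / d) * (?a + d) ^ Suc p" by (simp add: algebra_simps)
  finally show ?case .
qed

lemma poly_deriv_le:
  assumes "bounded_multilinear (Suc p) F C" "0 < d"
  shows "norm (poly_deriv F p x y) \<le> C * (norm x + d) ^ Suc p / d * norm y"
  using assms(1)
proof (induction p arbitrary: F C)
  case 0
  have "norm (F [y]) \<le> C * norm y"
    using bounded_multilinear_norm_le[OF 0, of "[y]"] by simp
  also have "\<dots> \<le> C * (norm x + d) / d * norm y"
    using bounded_multilinear_nonneg[OF 0] assms(2) by (simp add: field_simps)
  finally show ?case by (simp add: poly_deriv_def)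
next
  case (Suc p)
  note C = bounded_multilinear_nonneg[OF Suc.prems]
  let ?a = "norm x" and ?b = "norm y"
  have "norm (F (y # replicate (Suc p) x)) \<le> C * ?b * ?a ^ Suc p"
    using bounded_multilinear_replicate_le[OF bounded_multilinear_Cons[OF Suc.prems, of y], of x] .
  also have "\<dots> \<le> C * ?b * (?a + d) ^ Suc p"
    using C assms(2) by (intro mult_left_mono power_mono) auto
  finally have 1: "norm (F (y # replicate (Suc p) x)) \<le> C * ?b * (?a + d) ^ Suc p" .
  have 2: "norm (poly_deriv (\<lambda>xs. F (x # xs)) p x y) \<le> C * ?a * (?a + d) ^ Suc p / d * ?b"
    using Suc.IH[OF bounded_multilinear_Cons[OF Suc.prems, of x]] .
  have "norm (poly_deriv F (Suc p) x y)
      \<le> C * ?b * (?a + d) ^ Suc p + C * ?a * (?a + d) ^ Suc p / d * ?b"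
    unfolding poly_deriv_Suc by (rule norm_triangle_le[OF add_mono[OF 1 2]])
  also have "\<dots> = C * (?a + d) ^ Suc (Suc p) / d * ?b"
    using assms(2) by (simp add: field_simps)
  finally show ?case .
qed

text \<open>
  Splitting off the first argument leaves the remainder of a form of lower order, with first argument
  \<open>x\<close>, and an increment with first argument \<open>y\<close>; the two factors \<open>norm y / d\<close> come from these.
\<close>
lemma poly_deriv_remainder_le:
  assumes "bounded_multilinear (Suc p) F C" "0 < d" "norm y \<le> d"
  shows "norm (F (replicate (Suc p) (x + y)) - F (replicate (Suc p) x) - poly_deriv F p x y)
      \<le> C * (norm x + d) ^ Suc p * (norm y / d)\<^sup>2"
  using assms(1)
proof (induction p arbitrary: F C)
  case 0
  have "linear (\<lambda>x. F [x])" using bounded_multilinear_linear_hd[OF 0, of "[]"] by simp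
  then have "F [x + y] = F [x] + F [y]" by (rule linear_add)
  then show ?case using bounded_multilinear_nonneg[OF 0] assms by (simp add: poly_deriv_def)
next
  case (Suc p)
  note C = bounded_multilinear_nonneg[OF Suc.prems]
  let ?a = "norm x" and ?b = "norm y" and ?q = "Suc p"
  let ?X = "replicate ?q x" and ?Z = "replicate ?q (x + y)"
  have add: "F ((x + y) # ?Z) = F (x # ?Z) + F (y # ?Z)"
    by (rule linear_add[OF bounded_multilinear_linear_hd[OF Suc.prems]]) simp
  have 1: "norm (F (x # ?Z) - F (x # ?X) - poly_deriv (\<lambda>xs. F (x # xs)) p x y)
      \<le> C * ?a * (?a + d) ^ ?q * (?b / d)\<^sup>2"
    using Suc.IH[OF bounded_multilinear_Cons[OF Suc.prems, of x]] .
  have 2: "norm (F (y # ?Z) - F (y # ?X)) \<le> C * ?b * (?b / d) * (?a + d) ^ ?q"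
    using multilinear_increment_le[OF bounded_multilinear_Cons[OF Suc.prems, of y] assms(2,3)] .
  have "norm (F (replicate (Suc ?q) (x + y)) - F (replicate (Suc ?q) x) - poly_deriv F ?q x y)
      = norm ((F (x # ?Z) - F (x # ?X) - poly_deriv (\<lambda>xs. F (x # xs)) p x y)
            + (F (y # ?Z) - F (y # ?X)))"
    unfolding poly_deriv_Suc using add by (simp add: algebra_simps)
  also have "\<dots> \<le> C * ?a * (?a + d) ^ ?q * (?b / d)\<^sup>2 + C * ?b * (?b / d) * (?a + d) ^ ?q"
    by (rule norm_triangle_le[OF add_mono[OF 1 2]])
  also have "\<dots> = C * (?a + d) ^ Suc ?q * (?b / d)\<^sup>2"
    using assms(2) by (simp add: field_simps power2_eq_square)
  finally show ?case .
qed

section \<open>Majorants and Cauchy estimates\<close>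

definition majorant :: "real \<Rightarrow> (nat \<Rightarrow> real) \<Rightarrow> bool" where
  "majorant \<rho> m \<longleftrightarrow> (\<forall>p. 0 \<le> m p) \<and> (\<forall>z. 0 \<le> z \<longrightarrow> z < \<rho> \<longrightarrow> summable (\<lambda>p. m p * z ^ p))"

definition majorized ::
    "real \<Rightarrow> (nat \<Rightarrow> real) \<Rightarrow> ('a::real_normed_vector \<Rightarrow> 'b::real_normed_vector) \<Rightarrow> bool" where
  "majorized \<rho> m g \<longleftrightarrow> (\<exists>G. (\<forall>p. bounded_multilinear p (G p) (m p)) \<and>
     (\<forall>x. norm x < \<rho> \<longrightarrow> (\<lambda>p. G p (replicate p x)) sums g x))"

definition power_sum :: "(nat \<Rightarrow> real) \<Rightarrow> real \<Rightarrow> real" where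
  "power_sum m z = (\<Sum>p. m p * z ^ p)"

text \<open>
  What remains of a majorant after all information on derivatives of higher order is given up.  The
  bounds are linear in \<open>W\<close> and stable under integration of \<open>h\<close> with respect to a parameter.
\<close>
definition cauchy_estimates :: "real \<Rightarrow> (real \<Rightarrow> real) \<Rightarrow> ('a::real_normed_vector \<Rightarrow> real) \<Rightarrow> bool" where
  "cauchy_estimates \<rho> W h \<longleftrightarrow> (\<forall>x. norm x < \<rho> \<longrightarrow> h differentiable (at x) \<and> \<bar>h x\<bar> \<le> W (norm x) \<and>
     (\<forall>d>0. norm x + d < \<rho> \<longrightarrow>
        (\<forall>y. \<bar>frechet_derivative h (at x) y\<bar> \<le> W (norm x + d) / d * norm y) \<and>
        (\<forall>y. norm y \<le> d \<longrightarrow>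
           \<bar>h (x + y) - h x - frechet_derivative h (at x) y\<bar> \<le> W (norm x + d) * (norm y / d)\<^sup>2)))"

lemma has_derivative_of_quadratic_remainder:
  fixes h :: "'a::real_normed_vector \<Rightarrow> 'b::real_normed_vector"
  assumes "linear A" "\<And>y. norm (A y) \<le> K * norm y" "0 < d"
    and rem: "\<And>y. norm y \<le> d \<Longrightarrow> norm (h (x + y) - h x - A y) \<le> B * (norm y)\<^sup>2"
  shows "(h has_derivative A) (at x)"
  unfolding has_derivative_at
proof
  interpret A: linear A by fact
  show "bounded_linear A"
    by (rule bounded_linear_intro[where K=K]) (use assms(2) in \<open>auto simp: A.add A.scale mult.commute\<close>)
  have ev: "\<forall>\<^sub>F y in at 0. norm (norm (h (x + y) - h x - A y) / norm y) \<le> \<bar>B\<bar> * norm y"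
    unfolding eventually_at
  proof (intro exI[of _ d] conjI ballI impI)
    fix y :: 'a assume y: "y \<noteq> 0 \<and> dist y 0 < d"
    have "norm (h (x + y) - h x - A y) \<le> B * (norm y)\<^sup>2" using rem[of y] y by simp
    also have "\<dots> \<le> \<bar>B\<bar> * (norm y)\<^sup>2" by (intro mult_right_mono) auto
    finally show "norm (norm (h (x + y) - h x - A y) / norm y) \<le> \<bar>B\<bar> * norm y"
      using y by (simp add: field_simps power2_eq_square)
  qed (rule \<open>0 < d\<close>)
  have "((\<lambda>y::'a. \<bar>B\<bar> * norm y) \<longlongrightarrow> \<bar>B\<bar> * norm (0::'a)) (at 0)" by (intro tendsto_intros)
  then show "((\<lambda>y. norm (h (x + y) - h x - A y) / norm y) \<longlongrightarrow> 0) (at 0)"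
    by (intro Lim_null_comparison[OF ev]) auto
qed

lemma cauchy_estimatesI:
  fixes h :: "'a::real_normed_vector \<Rightarrow> real"
  assumes lin: "\<And>x. norm x < \<rho> \<Longrightarrow> linear (h' x)"
    and val: "\<And>x. norm x < \<rho> \<Longrightarrow> \<bar>h x\<bar> \<le> W (norm x)"
    and der: "\<And>x d y. 0 < d \<Longrightarrow> norm x + d < \<rho> \<Longrightarrow> \<bar>h' x y\<bar> \<le> W (norm x + d) / d * norm y"
    and rem: "\<And>x d y. 0 < d \<Longrightarrow> norm x + d < \<rho> \<Longrightarrow> norm y \<le> d \<Longrightarrow>
                \<bar>h (x + y) - h x - h' x y\<bar> \<le> W (norm x + d) * (norm y / d)\<^sup>2"
  shows "cauchy_estimates \<rho> W h" and "\<And>x. norm x < \<rho> \<Longrightarrow> (h has_derivative h' x) (at x)"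
proof -
  show der': "(h has_derivative h' x) (at x)" if x: "norm x < \<rho>" for x
  proof -
    obtain d where d: "0 < d" "norm x + d < \<rho>"
      using x dense[of 0 "\<rho> - norm x"] by (auto simp: algebra_simps)
    show ?thesis
    proof (rule has_derivative_of_quadratic_remainder[OF lin[OF x] _ d(1)])
      show "norm (h' x y) \<le> W (norm x + d) / d * norm y" for y using der[OF d] by simp
      show "norm (h (x + y) - h x - h' x y) \<le> (W (norm x + d) / d\<^sup>2) * (norm y)\<^sup>2"
        if "norm y \<le> d" for y
        using rem[OF d that] by (simp add: power_divide)
    qed
  qed
  have "frechet_derivative h (at x) = h' x" if "norm x < \<rho>" for x
    using frechet_derivative_at[OF der'[OF that]] by simp
  moreover have "norm x < \<rho>" if "0 < d" "norm x + d < \<rho>" for x :: 'a and d using that by simp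
  ultimately show "cauchy_estimates \<rho> W h"
    unfolding cauchy_estimates_def using val der rem differentiableI[OF der'] by simp
qed

lemma majorant_nonneg: "majorant \<rho> m \<Longrightarrow> 0 \<le> m p"
  by (simp add: majorant_def)

lemma majorant_summable: "majorant \<rho> m \<Longrightarrow> 0 \<le> z \<Longrightarrow> z < \<rho> \<Longrightarrow> summable (\<lambda>p. m p * z ^ p)"
  by (simp add: majorant_def)

lemma power_sum_mono:
  assumes "majorant \<rho> m" "0 \<le> y" "y \<le> z" "z < \<rho>"
  shows "power_sum m y \<le> power_sum m z"
  unfolding power_sum_def using assms
  by (intro suminf_le majorant_summable[OF assms(1)] mult_left_mono power_mono) (auto simp: majorant_def)

lemma power_sum_nonneg:
  assumes "majorant \<rho> m" "0 \<le> z" "z < \<rho>"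
  shows "0 \<le> power_sum m z"
  unfolding power_sum_def using assms by (intro suminf_nonneg majorant_summable) (auto simp: majorant_def)

text \<open>
  The double series converges absolutely, so it may be summed over antidiagonals.  This
  regroups the Lie derivative \<open>\<Sum>p. D\<^sub>p (\<Sum>q. v\<^sub>q)\<close> by total degree.
\<close>
lemma bilinear_cauchy_product_sums:
  fixes B :: "nat \<Rightarrow> 'a::banach \<Rightarrow> real"
  assumes lin: "\<And>p. linear (B p)" and bnd: "\<And>p y. \<bar>B p y\<bar> \<le> b p * norm y"
    and b: "summable b" and v: "summable (\<lambda>q. norm (v q))"
  shows "(\<lambda>n. \<Sum>q\<le>n. B (n - q) (v q)) sums (\<Sum>p. B p (\<Sum>q. v q))"
proof -
  have bl: "bounded_linear (B p)" for p
    using lin[of p] by (intro bounded_linear_intro[where K="b p"])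
      (use bnd lin[of p] in \<open>auto simp: linear_add linear_scale mult.commute\<close>)
  have vs: "v sums (\<Sum>q. v q)" using summable_norm_cancel[OF v] by (simp add: summable_sums)
  have absq: "summable (\<lambda>q. norm (B p (v q)))" for p
  proof (rule summable_comparison_test[of _ "\<lambda>q. b p * norm (v q)"])
    show "summable (\<lambda>q. b p * norm (v q))" using v by (rule summable_mult)
  qed (use bnd in auto)
  have row: "((\<lambda>q. B p (v q)) has_sum B p (\<Sum>q. v q)) UNIV" for p
    by (rule norm_summable_imp_has_sum[OF absq bounded_linear.sums[OF bl vs]])
  have "(\<lambda>(p, q). norm (B p (v q))) summable_on (UNIV \<times> UNIV)"
  proof -
    have sum_norm: "((\<lambda>q. norm (B p (v q))) has_sum (\<Sum>q. norm (B p (v q)))) UNIV" for p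
      by (rule norm_summable_imp_has_sum) (use absq[of p] in \<open>auto simp: summable_sums\<close>)
    have le: "(\<Sum>q. norm (B p (v q))) \<le> b p * (\<Sum>q. norm (v q))" for p
      using bnd[of p] v by (subst suminf_mult[symmetric]) (auto intro!: suminf_le absq[simplified] summable_mult)
    have "summable (\<lambda>p. \<Sum>q. norm (B p (v q)))"
      by (rule summable_comparison_test[OF _ summable_mult2[OF b, of "\<Sum>q. norm (v q)"]])
         (use le suminf_nonneg[OF absq] in auto)
    then have "(\<lambda>p. \<Sum>q. norm (B p (v q))) summable_on UNIV"
      using suminf_nonneg[OF absq] by (intro norm_summable_imp_summable_on) auto
    then show ?thesis
      using sum_norm by (intro summable_on_SigmaI) auto
  qed
  then have "(\<lambda>z. norm (B (fst z) (v (snd z)))) summable_on (UNIV \<times> UNIV)"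
    by (simp add: case_prod_unfold)
  then have "(\<lambda>(p, q). B p (v q)) summable_on (UNIV \<times> UNIV)"
    unfolding case_prod_unfold by (rule abs_summable_summable)
  then obtain S where S: "((\<lambda>(p,q). B p (v q)) has_sum S) (UNIV \<times> UNIV)" by (auto simp: summable_on_def)
  have "((\<lambda>p. B p (\<Sum>q. v q)) has_sum S) UNIV"
    by (rule has_sum_SigmaD[OF S]) (use row in auto)
  then have S_eq: "S = (\<Sum>p. B p (\<Sum>q. v q))" using has_sum_imp_sums sums_unique by blast
  have "((\<lambda>(n,q). B (n - q) (v q)) has_sum S) (Sigma UNIV (\<lambda>n. {..n}))"
    by (rule iffD1[OF has_sum_reindex_bij_witness[of "UNIV \<times> UNIV" "\<lambda>(n,q). (n-q,q)" "\<lambda>(p,q). (p+q,q)"] S]) auto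
  then have "((\<lambda>n. \<Sum>q\<le>n. B (n - q) (v q)) has_sum S) UNIV"
    by (rule has_sum_SigmaD) (auto intro!: has_sum_finiteI)
  then show ?thesis using has_sum_imp_sums S_eq by blast
qed

text \<open>
  Summation of the bounds for single forms.  The derivative is determined explicitly since the Lie
  derivative has to be expanded in a series again.
\<close>
lemma multilinear_series_cauchy_estimates:
  fixes G :: "nat \<Rightarrow> 'a::real_normed_vector list \<Rightarrow> real"
  assumes m: "majorant \<rho> m" and G: "\<And>p. bounded_multilinear p (G p) (m p)"
    and sums: "\<And>x. norm x < \<rho> \<Longrightarrow> (\<lambda>p. G p (replicate p x)) sums g x"
  shows "cauchy_estimates \<rho> (power_sum m) g"
    and "\<And>x. norm x < \<rho> \<Longrightarrow> (g has_derivative (\<lambda>y. \<Sum>p. poly_deriv (G (Suc p)) p x y)) (at x)"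
proof -
  define D where "D x y = (\<Sum>p. poly_deriv (G (Suc p)) p x y)" for x y
  have tail: "summable (\<lambda>p. m (Suc p) * z ^ Suc p)" "(\<Sum>p. m (Suc p) * z ^ Suc p) \<le> power_sum m z"
    if "0 \<le> z" "z < \<rho>" for z
  proof -
    note s = majorant_summable[OF m that]
    show "summable (\<lambda>p. m (Suc p) * z ^ Suc p)" using s by (subst summable_Suc_iff)
    show "(\<Sum>p. m (Suc p) * z ^ Suc p) \<le> power_sum m z"
      unfolding power_sum_def using suminf_split_head[OF s] majorant_nonneg[OF m, of 0] by simp
  qed
  have Dterm: "norm (poly_deriv (G (Suc p)) p x y) \<le> m (Suc p) * (norm x + d) ^ Suc p * (norm y / d)"
    if "0 < d" for x y d p
    using poly_deriv_le[OF G that, of p x y] by simp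
  have Dsum: "summable (\<lambda>p. poly_deriv (G (Suc p)) p x y)" if x: "norm x < \<rho>" for x y
  proof -
    obtain d where d: "0 < d" "norm x + d < \<rho>"
      using x dense[of 0 "\<rho> - norm x"] by (auto simp: algebra_simps)
    have "summable (\<lambda>p. m (Suc p) * (norm x + d) ^ Suc p * (norm y / d))"
      using d by (intro summable_mult2 tail) auto
    then show ?thesis
      by (rule summable_comparison_test[rotated]) (use Dterm[OF d(1)] in blast)
  qed
  have lin: "linear (D x)" if x: "norm x < \<rho>" for x
  proof
    note lin1 = poly_deriv_linear[OF G]
    show "D x (y + z) = D x y + D x z" for y z
      unfolding D_def by (simp add: linear_add[OF lin1] suminf_add Dsum[OF x])
    show "D x (c *\<^sub>R y) = c *\<^sub>R D x y" for c y
      unfolding D_def by (simp add: linear_scale[OF lin1] suminf_mult Dsum[OF x])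
  qed
  have val: "\<bar>g x\<bar> \<le> power_sum m (norm x)" if x: "norm x < \<rho>" for x
  proof -
    have "norm (\<Sum>p. G p (replicate p x)) \<le> power_sum m (norm x)"
      unfolding power_sum_def using x
      by (intro norm_suminf_le bounded_multilinear_replicate_le G majorant_summable[OF m]) auto
    then show ?thesis using sums_unique[OF sums[OF x]] by simp
  qed
  have der: "\<bar>D x y\<bar> \<le> power_sum m (norm x + d) / d * norm y" if d: "0 < d" "norm x + d < \<rho>" for x d y
  proof -
    have s: "summable (\<lambda>p. m (Suc p) * (norm x + d) ^ Suc p)" using d by (intro tail) auto
    have "norm (D x y) \<le> (\<Sum>p. m (Suc p) * (norm x + d) ^ Suc p * (norm y / d))"
      unfolding D_def by (intro norm_suminf_le Dterm d summable_mult2 s)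
    also have "\<dots> = (\<Sum>p. m (Suc p) * (norm x + d) ^ Suc p) * (norm y / d)"
      by (rule suminf_mult2[OF s, symmetric])
    also have "\<dots> \<le> power_sum m (norm x + d) * (norm y / d)"
      using d by (intro mult_right_mono tail) auto
    finally show ?thesis by simp
  qed
  have rem: "\<bar>g (x + y) - g x - D x y\<bar> \<le> power_sum m (norm x + d) * (norm y / d)\<^sup>2"
    if d: "0 < d" "norm x + d < \<rho>" "norm y \<le> d" for x d y
  proof -
    let ?r = "\<lambda>p. G (Suc p) (replicate (Suc p) (x + y)) - G (Suc p) (replicate (Suc p) x)
                   - poly_deriv (G (Suc p)) p x y"
    have x: "norm x < \<rho>" and xy: "norm (x + y) < \<rho>"
      using d norm_triangle_ineq[of x y] by auto
    have "(\<lambda>p. G p (replicate p (x + y)) - G p (replicate p x)) sums (g (x + y) - g x)"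
      by (intro sums_diff sums x xy)
    then have "(\<lambda>p. G (Suc p) (replicate (Suc p) (x + y)) - G (Suc p) (replicate (Suc p) x))
        sums (g (x + y) - g x)"
      by (subst sums_Suc_iff) simp
    then have "?r sums (g (x + y) - g x - D x y)"
      unfolding D_def by (rule sums_diff[OF _ summable_sums[OF Dsum[OF x]]])
    then have eq: "g (x + y) - g x - D x y = (\<Sum>p. ?r p)" by (rule sums_unique)
    have s: "summable (\<lambda>p. m (Suc p) * (norm x + d) ^ Suc p)" using d by (intro tail) auto
    have "norm (\<Sum>p. ?r p) \<le> (\<Sum>p. m (Suc p) * (norm x + d) ^ Suc p * (norm y / d)\<^sup>2)"
      by (intro norm_suminf_le poly_deriv_remainder_le G d summable_mult2 s)
    also have "\<dots> = (\<Sum>p. m (Suc p) * (norm x + d) ^ Suc p) * (norm y / d)\<^sup>2"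
      by (rule suminf_mult2[OF s, symmetric])
    also have "\<dots> \<le> power_sum m (norm x + d) * (norm y / d)\<^sup>2"
      using d by (intro mult_right_mono tail) auto
    finally show ?thesis unfolding eq by simp
  qed
  show "cauchy_estimates \<rho> (power_sum m) g" by (rule cauchy_estimatesI(1)[OF lin val der rem])
  show "(g has_derivative (\<lambda>y. \<Sum>p. poly_deriv (G (Suc p)) p x y)) (at x)" if "norm x < \<rho>" for x
    using cauchy_estimatesI(2)[OF lin val der rem that] unfolding D_def .
qed

lemma majorized_cauchy_estimates:
  fixes g :: "'a::real_normed_vector \<Rightarrow> real"
  shows "majorant \<rho> m \<Longrightarrow> majorized \<rho> m g \<Longrightarrow> cauchy_estimates \<rho> (power_sum m) g"
  unfolding majorized_def using multilinear_series_cauchy_estimates(1) by blast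

section \<open>Lie derivatives of majorized functions\<close>

text \<open>The coefficients of the power series \<open>X m'\<close>, the Lie derivative of \<open>m\<close> in one dimension.\<close>
definition lie_coeff :: "(nat \<Rightarrow> real) \<Rightarrow> (nat \<Rightarrow> real) \<Rightarrow> nat \<Rightarrow> real" where
  "lie_coeff X m n = (\<Sum>q\<le>n. X q * diffs m (n - q))"

lemma summable_diffs:
  assumes "majorant \<rho> m" "0 \<le> z" "z < \<rho>"
  shows "summable (\<lambda>p. diffs m p * z ^ p)"
proof (rule termdiff_converges[of z \<rho>])
  show "norm z < \<rho>" using assms by simp
  show "summable (\<lambda>p. m p * x ^ p)" if "norm x < \<rho>" for x
    by (rule summable_norm_cancel)
       (use majorant_summable[OF assms(1), of "norm x"] that majorant_nonneg[OF assms(1)] in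
         \<open>simp add: abs_mult power_abs\<close>)
qed

lemma majorant_diffs: "majorant \<rho> m \<Longrightarrow> majorant \<rho> (diffs m)"
  using summable_diffs unfolding majorant_def by (auto simp: diffs_def)

lemma power_sum_has_derivative:
  assumes "majorant \<rho> m" "0 \<le> z" "z < \<rho>"
  shows "(power_sum m has_real_derivative power_sum (diffs m) z) (at z)"
proof -
  obtain K where "z < K" "K < \<rho>" using assms(3) dense by blast
  then show ?thesis
    unfolding power_sum_def using assms by (intro termdiffs_strong[of m K] majorant_summable[OF assms(1)]) auto
qed

lemma lie_coeff_power_sum:
  assumes X: "majorant \<rho> X" and m: "majorant \<rho> m"
  shows "majorant \<rho> (lie_coeff X m)"
    and "\<And>z. 0 \<le> z \<Longrightarrow> z < \<rho> \<Longrightarrow> power_sum (lie_coeff X m) z = power_sum X z * power_sum (diffs m) z"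
proof -
  have eq: "(\<Sum>q\<le>n. (X q * z ^ q) * (diffs m (n - q) * z ^ (n - q))) = lie_coeff X m n * z ^ n" for n z
    unfolding lie_coeff_def sum_distrib_right
    by (intro sum.cong refl) (simp add: mult.assoc mult.left_commute power_add[symmetric])
  have nn: "0 \<le> lie_coeff X m n" for n
    unfolding lie_coeff_def using majorant_nonneg[OF X] majorant_nonneg[OF majorant_diffs[OF m]]
    by (intro sum_nonneg) auto
  have sums: "(\<lambda>n. lie_coeff X m n * z ^ n) sums (power_sum X z * power_sum (diffs m) z)" if z: "0 \<le> z" "z < \<rho>" for z
    unfolding power_sum_def eq[symmetric]
    using majorant_summable[OF X z] summable_diffs[OF m z] z majorant_nonneg[OF X]
      majorant_nonneg[OF majorant_diffs[OF m]]
    by (intro Cauchy_product_sums) auto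
  show "majorant \<rho> (lie_coeff X m)"
    unfolding majorant_def using nn sums sums_summable by blast
  show "power_sum (lie_coeff X m) z = power_sum X z * power_sum (diffs m) z" if "0 \<le> z" "z < \<rho>" for z
    unfolding power_sum_def[of "lie_coeff X m"] using sums_unique[OF sums[OF that]] by simp
qed

text \<open>
  The part of degree \<open>n\<close> of the Lie derivative: a form \<open>F q\<close> is applied to \<open>q\<close> consecutive arguments,
  and its value is inserted at that place into the form of \<open>G\<close> whose order makes the total degree \<open>n\<close>.
\<close>
definition lie_form ::
    "(nat \<Rightarrow> 'a list \<Rightarrow> 'a) \<Rightarrow> (nat \<Rightarrow> 'a list \<Rightarrow> 'b::comm_monoid_add) \<Rightarrow> nat \<Rightarrow> 'a list \<Rightarrow> 'b" where
  "lie_form F G n zs = (\<Sum>q\<le>n. \<Sum>i\<le>n - q.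
     G (Suc (n - q)) (take i zs @ F q (take q (drop i zs)) # drop (i + q) zs))"

lemma lie_form_replicate:
  "lie_form F G n (replicate n x) = (\<Sum>q\<le>n. poly_deriv (G (Suc (n - q))) (n - q) x (F q (replicate q x)))"
  unfolding lie_form_def poly_deriv_def
proof (intro sum.cong refl)
  fix q i assume "q \<in> {..n}" "i \<in> {..n - q}"
  then have "min i n = i" "min q (n - i) = q" "n - (i + q) = n - q - i" by auto
  then show "G (Suc (n - q)) (take i (replicate n x) @ F q (take q (drop i (replicate n x)))
        # drop (i + q) (replicate n x))
      = G (Suc (n - q)) (replicate i x @ F q (replicate q x) # replicate (n - q - i) x)" by simp
qed

text \<open>The varying argument lies before, inside or behind the block that is passed to \<open>F\<close>.\<close>
lemma insertion_linear:
  assumes F: "bounded_multilinear q F A" and G: "bounded_multilinear (Suc p) G B"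
    and len: "length us + length ws + 1 = p + q" and i: "i \<le> p"
  shows "linear (\<lambda>x. G (take i (us @ x # ws) @ F (take q (drop i (us @ x # ws))) # drop (i + q) (us @ x # ws)))"
proof -
  let ?l = "length us"
  consider "?l < i" | "i \<le> ?l" "?l < i + q" | "i + q \<le> ?l" by linarith
  then show ?thesis
  proof cases
    case 1
    then obtain k where k: "i = ?l + Suc k" using less_iff_Suc_add by auto
    show ?thesis
      using bounded_multilinear_linear[OF G,
        of us "take k ws @ F (take q (drop k ws)) # drop (k + q) ws"] len i k
      by (simp add: add.assoc)
  next
    case 2
    then obtain k where k: "i + q = ?l + Suc k" using less_iff_Suc_add by auto
    have q: "q - (?l - i) = Suc k" using 2 k by linarith
    have "linear (\<lambda>y. G (take i us @ y # drop k ws))"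
      using len i k 2 by (intro bounded_multilinear_linear[OF G]) auto
    moreover have "linear (\<lambda>x. F (drop i us @ x # take k ws))"
      using len i k 2 by (intro bounded_multilinear_linear[OF F]) auto
    ultimately have "linear ((\<lambda>y. G (take i us @ y # drop k ws)) \<circ> (\<lambda>x. F (drop i us @ x # take k ws)))"
      by (rule linear_compose[rotated])
    then show ?thesis using 2 q k by (simp add: o_def min_def)
  next
    case 3
    then show ?thesis
      using bounded_multilinear_linear[OF G,
        of "take i us @ F (take q (drop i us)) # drop (i + q) us" ws] len i
      by simp
  qed
qed

lemma insertion_norm_le:
  assumes F: "bounded_multilinear q F A" and G: "bounded_multilinear (Suc p) G B"
    and len: "length zs = p + q" and i: "i \<le> p"
  shows "norm (G (take i zs @ F (take q (drop i zs)) # drop (i + q) zs)) \<le> A * B * prod_list (map norm zs)"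
proof -
  let ?a = "take i zs" and ?b = "take q (drop i zs)" and ?c = "drop (i + q) zs"
  have "?b @ ?c = drop i zs" by (metis append_take_drop_id drop_drop add.commute)
  then have zs: "zs = ?a @ ?b @ ?c" by simp
  have prod_nn: "0 \<le> prod_list (map norm ws)" for ws :: "'a list"
    by (induction ws) auto
  have "norm (G (?a @ F ?b # ?c)) \<le> B * (prod_list (map norm ?a) * (norm (F ?b) * prod_list (map norm ?c)))"
    using bounded_multilinear_norm_le[OF G, of "?a @ F ?b # ?c"] len i by simp
  also have "\<dots> \<le> B * (prod_list (map norm ?a) * ((A * prod_list (map norm ?b)) * prod_list (map norm ?c)))"
    using bounded_multilinear_norm_le[OF F, of ?b] len i prod_nn bounded_multilinear_nonneg[OF G]
    by (intro mult_left_mono mult_right_mono) auto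
  also have "\<dots> = A * B * prod_list (map norm (?a @ ?b @ ?c))" by (simp add: mult_ac)
  finally show ?thesis using zs by simp
qed

lemma lie_form_bounded_multilinear:
  assumes F: "\<And>q. bounded_multilinear q (F q) (X q)" and G: "\<And>p. bounded_multilinear p (G p) (m p)"
  shows "bounded_multilinear n (lie_form F G n) (lie_coeff X m n)"
  unfolding bounded_multilinear_def tensor_bound_def
proof (intro conjI allI impI)
  fix us ws :: "'a list" assume len: "length us + length ws + 1 = n"
  show "linear (\<lambda>x. lie_form F G n (us @ x # ws))"
    unfolding lie_form_def using len
    by (intro linear_compose_sum ballI insertion_linear[OF F G]) auto
next
  show "0 \<le> lie_coeff X m n"
    unfolding lie_coeff_def diffs_def
    using bounded_multilinear_nonneg[OF F] bounded_multilinear_nonneg[OF G]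
    by (intro sum_nonneg mult_nonneg_nonneg) auto
next
  fix zs :: "'a list" assume len: "length zs = n"
  have "norm (lie_form F G n zs) \<le> (\<Sum>q\<le>n. \<Sum>i\<le>n - q. X q * m (Suc (n - q)) * prod_list (map norm zs))"
    unfolding lie_form_def using len
    by (intro sum_norm_le insertion_norm_le[OF F G]) auto
  also have "\<dots> = lie_coeff X m n * prod_list (map norm zs)"
    unfolding lie_coeff_def diffs_def sum_distrib_right
    by (intro sum.cong refl) (simp add: algebra_simps)
  finally show "norm (lie_form F G n zs) \<le> lie_coeff X m n * prod_list (map norm zs)" .
qed

text \<open>
  Composition of forms multiplies their norms, and a form of order \<open>p + 1\<close> offers \<open>p + 1\<close> slots for
  the insertion; the latter is the factor that differentiation puts on the coefficient \<open>m (p + 1)\<close>.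
\<close>
lemma majorized_lie:
  fixes v :: "'a::banach \<Rightarrow> 'a"
  assumes X: "majorant \<rho> X" and m: "majorant \<rho> m"
    and v: "majorized \<rho> X v" and g: "majorized \<rho> m g"
  shows "majorized \<rho> (lie_coeff X m) (lie v g)"
proof -
  obtain F where F: "\<And>q. bounded_multilinear q (F q) (X q)"
    and vs: "\<And>x. norm x < \<rho> \<Longrightarrow> (\<lambda>q. F q (replicate q x)) sums v x"
    using v unfolding majorized_def by blast
  obtain G where G: "\<And>p. bounded_multilinear p (G p) (m p)"
    and gs: "\<And>x. norm x < \<rho> \<Longrightarrow> (\<lambda>p. G p (replicate p x)) sums g x"
    using g unfolding majorized_def by blast
  have "(\<lambda>n. lie_form F G n (replicate n x)) sums lie v g x" if x: "norm x < \<rho>" for x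
  proof -
    obtain d where d: "0 < d" "norm x + d < \<rho>"
      using x dense[of 0 "\<rho> - norm x"] by (auto simp: algebra_simps)
    have "(\<lambda>n. \<Sum>q\<le>n. poly_deriv (G (Suc (n - q))) (n - q) x (F q (replicate q x))) sums
        (\<Sum>p. poly_deriv (G (Suc p)) p x (\<Sum>q. F q (replicate q x)))"
    proof (rule bilinear_cauchy_product_sums)
      show "linear (poly_deriv (G (Suc p)) p x)" for p by (rule poly_deriv_linear[OF G])
      show "\<bar>poly_deriv (G (Suc p)) p x y\<bar> \<le> m (Suc p) * (norm x + d) ^ Suc p / d * norm y" for p y
        using poly_deriv_le[OF G d(1), of p x y] by simp
      have "summable (\<lambda>p. m p * (norm x + d) ^ p)"
        using d by (intro majorant_summable[OF m]) auto
      then show "summable (\<lambda>p. m (Suc p) * (norm x + d) ^ Suc p / d)"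
        by (intro summable_divide) (subst summable_Suc_iff)
      show "summable (\<lambda>q. norm (F q (replicate q x)))"
        by (rule summable_comparison_test[OF _ majorant_summable[OF X norm_ge_zero x]])
           (use bounded_multilinear_replicate_le[OF F] in auto)
    qed
    moreover have "frechet_derivative g (at x) = (\<lambda>y. \<Sum>p. poly_deriv (G (Suc p)) p x y)"
      by (rule frechet_derivative_at[symmetric, OF multilinear_series_cauchy_estimates(2)[OF m G gs x]])
    ultimately show ?thesis
      unfolding lie_form_replicate lie_def using sums_unique[OF vs[OF x]] by simp
  qed
  then show ?thesis
    unfolding majorized_def using lie_form_bounded_multilinear[OF F G] by blast
qed

section \<open>The scalar majorant along the flow\<close>

lemma nonincreasing_of_derivative_within:
  fixes f :: "real \<Rightarrow> real"
  assumes ab: "a \<le> b" and der: "\<And>s. s \<in> {a..b} \<Longrightarrow> (f has_real_derivative f' s) (at s within {a..b})"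
    and neg: "\<And>s. s \<in> {a<..<b} \<Longrightarrow> f' s \<le> 0"
  shows "f b \<le> f a"
proof (cases "a = b")
  case False
  then have "a < b" using ab by simp
  then obtain s where "s \<in> {a<..<b}" "f b - f a = f' s * (b - a)"
    using mvt_simple[of a b f "\<lambda>s. (*) (f' s)"] der unfolding has_field_derivative_def by fastforce
  then show ?thesis using mult_nonpos_nonneg[OF neg, of s "b - a"] \<open>a < b\<close> by simp
qed simp

text \<open>
  For an exact orbit of the flow of \<open>- lam Y\<close>, the functions \<open>P\<^sub>j = lam\<^sup>j M\<^sub>j \<circ> \<zeta>\<close> satisfy
  \<open>P\<^sub>j' = - P\<^sub>j\<^sub>+\<^sub>1\<close>, and the claim says that a Taylor term of \<open>P\<^sub>j\<close> around \<open>b\<close> is at most the value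
  at \<open>a\<close>, all terms being nonnegative.  A supersolution has \<open>P\<^sub>j' \<le> - P\<^sub>j\<^sub>+\<^sub>1\<close>, which is all that the
  induction on \<open>k\<close> needs.
\<close>
lemma supersolution_taylor_bound:
  fixes m Y :: "nat \<Rightarrow> real" and \<zeta> \<zeta>' :: "real \<Rightarrow> real"
  defines "M \<equiv> \<lambda>k. (lie_coeff Y ^^ k) m"
  assumes m: "majorant \<rho> m" and Y: "majorant \<rho> Y" and lam: "0 \<le> lam"
    and range: "\<And>s. s \<in> {0..T} \<Longrightarrow> 0 \<le> \<zeta> s \<and> \<zeta> s < \<rho>"
    and der: "\<And>s. s \<in> {0..T} \<Longrightarrow> (\<zeta> has_real_derivative \<zeta>' s) (at s within {0..T})"
    and super: "\<And>s. s \<in> {0..T} \<Longrightarrow> \<zeta>' s \<le> - lam * power_sum Y (\<zeta> s)"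
    and ab: "0 \<le> a" "a \<le> b" "b \<le> T"
  shows "(b - a) ^ k / fact k * (lam ^ (j + k) * power_sum (M (j + k)) (\<zeta> b)) \<le> lam ^ j * power_sum (M j) (\<zeta> a)"
  using ab
proof (induction k arbitrary: j a)
  have M: "majorant \<rho> (M k)" for k
    unfolding M_def by (induction k) (auto simp: m lie_coeff_power_sum(1)[OF Y])
  have M_Suc: "M (Suc k) = lie_coeff Y (M k)" for k by (simp add: M_def)
  define P where "P j s = lam ^ j * power_sum (M j) (\<zeta> s)" for j s
  define P' where "P' j s = lam ^ j * (power_sum (diffs (M j)) (\<zeta> s) * \<zeta>' s)" for j s
  have P_nonneg: "0 \<le> P j s" if "s \<in> {0..T}" for j s
    unfolding P_def using range[OF that] power_sum_nonneg[OF M] lam by simp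
  have P_der: "(P j has_real_derivative P' j s) (at s within {0..T})" if "s \<in> {0..T}" for j s
    unfolding P_def P'_def using range[OF that]
    by (intro DERIV_cmult DERIV_chain'[OF der[OF that]] power_sum_has_derivative[OF M]) auto
  have P'_le: "P' j s \<le> - P (Suc j) s" if s: "s \<in> {0..T}" for j s
  proof -
    have "power_sum (diffs (M j)) (\<zeta> s) * \<zeta>' s \<le> power_sum (diffs (M j)) (\<zeta> s) * (- lam * power_sum Y (\<zeta> s))"
      using range[OF s] power_sum_nonneg[OF majorant_diffs[OF M]] by (intro mult_left_mono super[OF s]) auto
    also have "\<dots> = - lam * power_sum (M (Suc j)) (\<zeta> s)"
      unfolding M_Suc using range[OF s] by (simp add: lie_coeff_power_sum(2)[OF Y M])
    finally have "P' j s \<le> lam ^ j * (- lam * power_sum (M (Suc j)) (\<zeta> s))"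
      unfolding P'_def using lam by (intro mult_left_mono) auto
    then show ?thesis by (simp add: P_def mult_ac)
  qed
  {
    case (0 j a)
    have "P j b \<le> P j a"
    proof (rule nonincreasing_of_derivative_within[OF \<open>a \<le> b\<close>])
      fix s assume s: "s \<in> {a..b}"
      then have sT: "s \<in> {0..T}" using 0 by auto
      show "(P j has_real_derivative P' j s) (at s within {a..b})"
        by (rule DERIV_subset[OF P_der[OF sT]]) (use 0 in auto)
    next
      fix s assume s: "s \<in> {a<..<b}"
      then have sT: "s \<in> {0..T}" using 0 by auto
      show "P' j s \<le> 0" using P'_le[OF sT, of j] P_nonneg[OF sT, of "Suc j"] by simp
    qed
    then show ?case by (simp add: P_def)
  next
    case (Suc k j a)
    define c where "c = P (j + Suc k) b"
    define E where "E s = P j s - (b - s) ^ Suc k / fact (Suc k) * c" for s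
    define E' where "E' s = P' j s + (b - s) ^ k / fact k * c" for s
    have E_der: "(E has_real_derivative E' s) (at s within {0..T})" if "s \<in> {0..T}" for s
    proof -
      have "((\<lambda>s. b - s) has_real_derivative - 1) (at s within {0..T})"
        by (auto intro!: derivative_eq_intros)
      from DERIV_diff[OF P_der[OF that, of j] DERIV_cmult[OF DERIV_power_Suc[OF this, of k], of "c / fact (Suc k)"]]
      have "((\<lambda>s. P j s - c / fact (Suc k) * (b - s) ^ Suc k) has_real_derivative
          P' j s - c / fact (Suc k) * ((1 + real k) * (- 1 * (b - s) ^ k))) (at s within {0..T})" .
      moreover have "c / fact (Suc k) * (1 + real k) = c / fact k"
        by (simp add: fact_Suc divide_simps)
      then have "P' j s - c / fact (Suc k) * ((1 + real k) * (- 1 * (b - s) ^ k)) = E' s"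
        unfolding E'_def by (metis (no_types, lifting) add_uminus_conv_diff diff_minus_eq_add mult.assoc
            mult.commute mult_minus1 mult_minus_right times_divide_eq_left)
      moreover have "E = (\<lambda>s. P j s - c / fact (Suc k) * (b - s) ^ Suc k)"
        unfolding E_def by (simp add: fun_eq_iff mult.commute)
      ultimately show ?thesis by simp
    qed
    have E'_le: "E' s \<le> 0" if s: "s \<in> {a..b}" for s
    proof -
      have sT: "s \<in> {0..T}" using s Suc.prems by auto
      have "(b - s) ^ k / fact k * c \<le> P (Suc j) s"
        using Suc.IH[of s "Suc j"] s Suc.prems unfolding c_def P_def by simp
      then show ?thesis using P'_le[OF sT, of j] unfolding E'_def by simp
    qed
    have "E b \<le> E a"
    proof (rule nonincreasing_of_derivative_within[OF \<open>a \<le> b\<close>])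
      show "(E has_real_derivative E' s) (at s within {a..b})" if "s \<in> {a..b}" for s
        by (rule DERIV_subset[OF E_der]) (use that Suc.prems in auto)
      show "E' s \<le> 0" if "s \<in> {a<..<b}" for s using E'_le that by simp
    qed
    moreover have "0 \<le> E b" using P_nonneg[of b j] Suc.prems by (simp add: E_def)
    ultimately show ?case unfolding E_def c_def P_def by simp
  }
qed

text \<open>
  After the last time at which \<open>\<gamma>\<close> is not positive it could only decrease, and so could not end at a
  positive value.
\<close>
lemma flow_positive_antimono:
  fixes \<gamma> :: "real \<Rightarrow> real"
  assumes der: "\<And>s. s \<in> {0..T} \<Longrightarrow> (\<gamma> has_real_derivative - G (\<gamma> s)) (at s within {0..T})"
    and G: "\<And>s. s \<in> {0..T} \<Longrightarrow> 0 \<le> \<gamma> s \<Longrightarrow> 0 \<le> G (\<gamma> s)"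
    and end_pos: "0 < \<gamma> T" and s: "s \<in> {0..T}"
  shows "0 < \<gamma> s \<and> \<gamma> s \<le> \<gamma> 0"
proof -
  have decr: "\<gamma> b \<le> \<gamma> a" if ab: "0 \<le> a" "a \<le> b" "b \<le> T" and pos: "\<And>s. s \<in> {a<..<b} \<Longrightarrow> 0 \<le> \<gamma> s" for a b
    by (rule nonincreasing_of_derivative_within[OF ab(2), of \<gamma> "\<lambda>s. - G (\<gamma> s)"])
       (use der G ab pos DERIV_subset[OF der, of _ "{a..b}"] in auto)
  have pos: "0 < \<gamma> s" if s: "s \<in> {0..T}" for s
  proof (rule ccontr)
    assume neg: "\<not> 0 < \<gamma> s"
    let ?A = "{u \<in> {s..T}. \<gamma> u \<le> 0}"
    have "continuous_on {0..T} \<gamma>" by (rule DERIV_continuous_on[OF der])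
    then have "continuous_on {s..T} \<gamma>" by (rule continuous_on_subset) (use s in auto)
    then have "closed ?A"
      by (intro continuous_on_closed_Collect_le continuous_intros closed_atLeastAtMost)
    moreover have "bounded ?A" by (rule bounded_subset[OF bounded_closed_interval[of s T]]) auto
    ultimately have "compact ?A" by (simp add: compact_eq_bounded_closed)
    moreover have "s \<in> ?A" using s neg by auto
    ultimately obtain c where c: "c \<in> ?A" "\<And>u. u \<in> ?A \<Longrightarrow> u \<le> c"
      using compact_attains_sup[of ?A] by blast
    have "\<gamma> T \<le> \<gamma> c"
    proof (rule decr)
      show "0 \<le> \<gamma> u" if "u \<in> {c<..<T}" for u using c(1) c(2)[of u] that by force
    qed (use c(1) s in auto)
    then show False using end_pos c(1) by auto
  qed
  moreover have "\<gamma> s \<le> \<gamma> 0" by (rule decr) (use s less_imp_le[OF pos] in auto)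
  ultimately show ?thesis using s by blast
qed

text \<open>
  The supersolution is \<open>\<zeta> s = \<gamma> s + \<epsilon> exp (L (T - s))\<close>.  Of the slope \<open>- L \<epsilon> exp (L (T - s))\<close> of the
  correction, the part with \<open>L - 1\<close>, a Lipschitz constant of \<open>X\<close>, pays for the passage from \<open>X (\<gamma> s)\<close>
  to \<open>X (\<zeta> s)\<close>.  The rest is at least \<open>\<epsilon>\<close> in absolute value and pays for two further losses, both
  of order \<open>\<eta>\<close>: the factor \<open>1 + \<eta>\<close>, whose powers give the geometric decay, and the increase of
  the coefficients from \<open>X\<close> to \<open>Y\<close>.  The strict inequality \<open>X p < Y p\<close> serves to realize the tensor
  norm, which is an infimum, by an actual form.
\<close>
lemma perturbed_flow_geometric_bound:
  fixes X :: "nat \<Rightarrow> real" and \<gamma> :: "real \<Rightarrow> real"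
  assumes X: "majorant \<rho> X" and R: "0 < R" "R < \<rho>" and T: "0 \<le> T"
    and \<gamma>0: "\<gamma> 0 = R" and \<gamma>T: "0 < \<gamma> T"
    and der: "\<And>s. s \<in> {0..T} \<Longrightarrow> (\<gamma> has_real_derivative - power_sum X (\<gamma> s)) (at s within {0..T})"
    and nonneg: "\<And>s. s \<in> {0..T} \<Longrightarrow> 0 \<le> \<gamma> s \<Longrightarrow> 0 \<le> power_sum X (\<gamma> s)"
  obtains \<delta> q Y where "0 < \<delta>" "0 \<le> q" "q < 1" "majorant \<rho> Y" "\<And>p. X p < Y p"
    "\<And>s. s \<in> {0..T} \<Longrightarrow> 0 < \<gamma> s \<and> \<gamma> s + 2 * \<delta> < \<rho>"
    "\<And>m. majorant \<rho> m \<Longrightarrow> \<exists>K. \<forall>s\<in>{0..T}. \<forall>k.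
       s ^ k / fact k * power_sum ((lie_coeff Y ^^ k) m) (\<gamma> s + 2 * \<delta>) \<le> K * q ^ k"
proof -
  have \<gamma>b: "0 < \<gamma> s \<and> \<gamma> s \<le> R" if "s \<in> {0..T}" for s
    using flow_positive_antimono[of T \<gamma> "power_sum X", OF der nonneg \<gamma>T that] \<gamma>0 by blast
  \<comment> \<open>Everything takes place up to the radius \<open>\<rho>'\<close>, where \<open>X\<close> and \<open>X'\<close> are bounded; \<open>\<epsilon>\<close> is chosen
    such that \<open>\<zeta> 0 = \<rho>'\<close>.\<close>
  define \<rho>' where "\<rho>' = (R + \<rho>) / 2"
  have \<rho>': "R < \<rho>'" "\<rho>' < \<rho>" "0 \<le> \<rho>'" using R by (auto simp: \<rho>'_def)
  define L where "L = power_sum (diffs X) \<rho>' + 1"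
  have L: "1 \<le> L" using power_sum_nonneg[OF majorant_diffs[OF X] \<rho>'(3,2)] by (simp add: L_def)
  define \<epsilon> where "\<epsilon> = (\<rho>' - R) / exp (L * T)"
  have \<epsilon>: "0 < \<epsilon>" using \<rho>' by (simp add: \<epsilon>_def)
  \<comment> \<open>The losses amount to at most \<open>\<eta> X(\<rho>') + 2 \<eta> (1 + \<eta>)\<close>, where \<open>2 (1 + \<eta>) \<le> 4\<close>.\<close>
  define \<eta> where "\<eta> = min 1 (\<epsilon> / (power_sum X \<rho>' + 4))"
  have X\<rho>': "0 \<le> power_sum X \<rho>'" using power_sum_nonneg[OF X \<rho>'(3,2)] .
  have \<eta>: "0 < \<eta>" "\<eta> \<le> 1" "\<eta> * (power_sum X \<rho>' + 4) \<le> \<epsilon>"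
  proof -
    show "0 < \<eta>" "\<eta> \<le> 1" using \<epsilon> X\<rho>' by (auto simp: \<eta>_def)
    have "\<eta> \<le> \<epsilon> / (power_sum X \<rho>' + 4)" by (simp add: \<eta>_def)
    then show "\<eta> * (power_sum X \<rho>' + 4) \<le> \<epsilon>" using X\<rho>' by (simp add: field_simps)
  qed
  define Y where "Y p = X p + \<eta> * (1 / (2 * \<rho>)) ^ p" for p
  have \<rho>0: "0 < \<rho>" using R by simp
  have geo: "summable (\<lambda>p. \<eta> * (1 / (2 * \<rho>)) ^ p * z ^ p)"
    "(\<Sum>p. \<eta> * (1 / (2 * \<rho>)) ^ p * z ^ p) \<le> 2 * \<eta>" if z: "0 \<le> z" "z < \<rho>" for z
  proof -
    have "(1 / (2 * \<rho>)) ^ p * z ^ p \<le> (1 / 2) ^ p" for p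
      unfolding power_mult_distrib[symmetric] using z by (intro power_mono) (auto simp: field_simps)
    then have le: "\<eta> * (1 / (2 * \<rho>)) ^ p * z ^ p \<le> \<eta> * (1 / 2) ^ p" for p
      using \<eta>(1) by (simp add: mult.assoc)
    have half: "(\<lambda>p. \<eta> * (1 / 2 :: real) ^ p) sums (\<eta> * 2)"
      using geometric_sums[of "1 / 2 :: real"] by (intro sums_mult) simp
    show s: "summable (\<lambda>p. \<eta> * (1 / (2 * \<rho>)) ^ p * z ^ p)"
      by (rule summable_comparison_test[OF _ sums_summable[OF half]]) (use le z \<eta> \<rho>0 in auto)
    show "(\<Sum>p. \<eta> * (1 / (2 * \<rho>)) ^ p * z ^ p) \<le> 2 * \<eta>"
      using suminf_le[OF le s sums_summable[OF half]] sums_unique[OF half] by simp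
  qed
  have XY: "X p < Y p" for p using \<eta> \<rho>0 by (simp add: Y_def)
  have Ysum: "summable (\<lambda>p. Y p * z ^ p)" "power_sum Y z \<le> power_sum X z + 2 * \<eta>" if z: "0 \<le> z" "z < \<rho>" for z
  proof -
    have "(\<lambda>p. X p * z ^ p + \<eta> * (1 / (2 * \<rho>)) ^ p * z ^ p) sums
        (power_sum X z + (\<Sum>p. \<eta> * (1 / (2 * \<rho>)) ^ p * z ^ p))"
      unfolding power_sum_def by (intro sums_add summable_sums majorant_summable[OF X] geo z)
    then have "(\<lambda>p. Y p * z ^ p) sums (power_sum X z + (\<Sum>p. \<eta> * (1 / (2 * \<rho>)) ^ p * z ^ p))"
      unfolding Y_def by (simp add: distrib_right)
    then show "summable (\<lambda>p. Y p * z ^ p)" "power_sum Y z \<le> power_sum X z + 2 * \<eta>"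
      unfolding power_sum_def[of Y] using geo(2)[OF z] by (auto simp: sums_iff)
  qed
  have Y: "majorant \<rho> Y"
    unfolding majorant_def using Ysum(1) order_trans[OF majorant_nonneg[OF X] less_imp_le[OF XY]] by blast
  define u where "u s = \<epsilon> * exp (L * (T - s))" for s
  define \<zeta> where "\<zeta> s = \<gamma> s + u s" for s
  define \<zeta>' where "\<zeta>' s = - power_sum X (\<gamma> s) - L * u s" for s
  have u: "\<epsilon> \<le> u s" "u s \<le> \<rho>' - R" if s: "s \<in> {0..T}" for s
  proof -
    show "\<epsilon> \<le> u s" using s \<epsilon> L by (simp add: u_def)
    have "u s \<le> \<epsilon> * exp (L * T)" unfolding u_def using s \<epsilon> L by (intro mult_left_mono) auto
    then show "u s \<le> \<rho>' - R" by (simp add: \<epsilon>_def)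
  qed
  have \<zeta>: "0 \<le> \<gamma> s" "\<gamma> s + \<epsilon> \<le> \<zeta> s" "\<zeta> s \<le> \<rho>'" if s: "s \<in> {0..T}" for s
    using \<gamma>b[OF s] u[OF s] unfolding \<zeta>_def by auto
  have \<zeta>_der: "(\<zeta> has_real_derivative \<zeta>' s) (at s within {0..T})" if s: "s \<in> {0..T}" for s
    unfolding \<zeta>_def \<zeta>'_def u_def using der[OF s] by (auto intro!: derivative_eq_intros)
  have super: "\<zeta>' s \<le> - (1 + \<eta>) * power_sum Y (\<zeta> s)" if s: "s \<in> {0..T}" for s
  proof -
    have lt: "\<gamma> s < \<zeta> s" using \<zeta>[OF s] \<epsilon> by simp
    obtain z where z: "\<gamma> s < z" "z < \<zeta> s" "power_sum X (\<zeta> s) - power_sum X (\<gamma> s) = (\<zeta> s - \<gamma> s) * power_sum (diffs X) z"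
      using MVT2[OF lt, of "power_sum X" "power_sum (diffs X)"] power_sum_has_derivative[OF X] \<zeta>[OF s] \<rho>' by force
    have "power_sum X (\<zeta> s) \<le> power_sum X (\<gamma> s) + u s * power_sum (diffs X) z"
      using z(3) by (simp add: \<zeta>_def)
    also have "\<dots> \<le> power_sum X (\<gamma> s) + u s * power_sum (diffs X) \<rho>'"
      using z \<zeta>[OF s] \<rho>' u[OF s] \<epsilon>
      by (intro add_left_mono mult_left_mono power_sum_mono[OF majorant_diffs[OF X]]) auto
    finally have X\<zeta>: "power_sum X (\<zeta> s) \<le> power_sum X (\<gamma> s) + (L - 1) * u s" by (simp add: L_def mult.commute)
    have "power_sum Y (\<zeta> s) \<le> power_sum X (\<zeta> s) + 2 * \<eta>" using \<zeta>[OF s] \<rho>' \<epsilon> by (intro Ysum) auto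
    then have "(1 + \<eta>) * power_sum Y (\<zeta> s) \<le> (1 + \<eta>) * (power_sum X (\<zeta> s) + 2 * \<eta>)"
      using \<eta> by (intro mult_left_mono) auto
    also have "\<dots> = power_sum X (\<zeta> s) + \<eta> * (power_sum X (\<zeta> s) + 2 * (1 + \<eta>))" by (simp add: algebra_simps)
    also have "\<dots> \<le> power_sum X (\<zeta> s) + \<eta> * (power_sum X \<rho>' + 4)"
      using \<eta> \<zeta>[OF s] \<rho>' \<epsilon> by (intro add_left_mono mult_left_mono add_mono power_sum_mono[OF X]) auto
    also have "\<dots> \<le> power_sum X (\<gamma> s) + (L - 1) * u s + u s"
      using X\<zeta> \<eta>(3) u[OF s] by (intro add_mono) auto
    finally show ?thesis by (simp add: \<zeta>'_def algebra_simps)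
  qed
  show thesis
  proof (rule that[of "\<epsilon> / 2" "1 / (1 + \<eta>)" Y])
    show "0 < \<gamma> s \<and> \<gamma> s + 2 * (\<epsilon> / 2) < \<rho>" if s: "s \<in> {0..T}" for s
      using \<gamma>b[OF s] \<zeta>[OF s] \<rho>' by auto
    fix m assume m: "majorant \<rho> m"
    define M where "M k = (lie_coeff Y ^^ k) m" for k
    have M: "majorant \<rho> (M k)" for k
      unfolding M_def by (induction k) (auto simp: m lie_coeff_power_sum(1)[OF Y])
    have "s ^ k / fact k * power_sum (M k) (\<gamma> s + \<epsilon>) \<le> power_sum m (\<zeta> 0) * (1 / (1 + \<eta>)) ^ k"
      if s: "s \<in> {0..T}" for s k
    proof -
      have "(s - 0) ^ k / fact k * ((1 + \<eta>) ^ (0 + k) * power_sum (M (0 + k)) (\<zeta> s))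
          \<le> (1 + \<eta>) ^ 0 * power_sum (M 0) (\<zeta> 0)"
        unfolding M_def
      proof (rule supersolution_taylor_bound[OF m Y _ _ \<zeta>_der super])
        show "0 \<le> \<zeta> r \<and> \<zeta> r < \<rho>" if "r \<in> {0..T}" for r
          using \<zeta>[OF that] \<epsilon> \<rho>' by auto
      qed (use s \<eta> in auto)
      then have "s ^ k / fact k * power_sum (M k) (\<zeta> s) \<le> power_sum m (\<zeta> 0) * (1 / (1 + \<eta>)) ^ k"
        using \<eta> by (simp add: M_def field_simps)
      moreover have "s ^ k / fact k * power_sum (M k) (\<gamma> s + \<epsilon>) \<le> s ^ k / fact k * power_sum (M k) (\<zeta> s)"
        using s \<zeta>[OF s] \<epsilon> \<rho>' by (intro mult_left_mono power_sum_mono[OF M]) auto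
      ultimately show ?thesis by simp
    qed
    then show "\<exists>K. \<forall>s\<in>{0..T}. \<forall>k.
        s ^ k / fact k * power_sum ((lie_coeff Y ^^ k) m) (\<gamma> s + 2 * (\<epsilon> / 2)) \<le> K * (1 / (1 + \<eta>)) ^ k"
      unfolding M_def by (intro exI[of _ "power_sum m (\<zeta> 0)"]) simp
  qed (use \<epsilon> \<eta> Y XY in auto)
qed

section \<open>Families with uniform Cauchy estimates\<close>

lemma cauchy_estimates_increment:
  assumes ce: "cauchy_estimates \<rho> W h" and d: "0 < d" "norm x + d < \<rho>" and y: "norm (y - x) \<le> d"
    and W: "0 \<le> W (norm x + d)"
  shows "\<bar>h y - h x\<bar> \<le> 2 * W (norm x + d) / d * norm (y - x)"
proof -
  let ?D = "frechet_derivative h (at x) (y - x)" and ?\<theta> = "norm (y - x) / d"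
  have x: "norm x < \<rho>" using d by simp
  have D: "\<bar>?D\<bar> \<le> W (norm x + d) / d * norm (y - x)"
    and R: "\<bar>h (x + (y - x)) - h x - ?D\<bar> \<le> W (norm x + d) * ?\<theta>\<^sup>2"
    using ce x d y unfolding cauchy_estimates_def by blast+
  have "?\<theta>\<^sup>2 \<le> ?\<theta>" using d y unfolding power2_eq_square
    by (intro mult_left_le) auto
  then have "W (norm x + d) * ?\<theta>\<^sup>2 \<le> W (norm x + d) * ?\<theta>" using W by (rule mult_left_mono)
  then show ?thesis using D R by simp
qed

text \<open>
  Continuity in the parameter is required for each point separately.  Uniform Lipschitz continuity in
  \<open>x\<close> makes it joint.  The remainder bound shows that the difference quotients with increment \<open>y / n\<close>
  converge to the derivative with an error of order \<open>1 / n\<close>, uniformly in the parameter and locally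
  uniformly in \<open>x\<close> and \<open>y\<close>.
\<close>
lemma cauchy_estimates_parametric_continuous:
  fixes H :: "'p::topological_space \<Rightarrow> 'a::real_normed_vector \<Rightarrow> real"
  assumes ce: "\<And>p. p \<in> P \<Longrightarrow> cauchy_estimates \<rho> W (H p)"
    and W: "\<And>z. 0 \<le> z \<Longrightarrow> z < \<rho> \<Longrightarrow> 0 \<le> W z"
    and W_mono: "\<And>y z. 0 \<le> y \<Longrightarrow> y \<le> z \<Longrightarrow> z < \<rho> \<Longrightarrow> W y \<le> W z"
    and cont: "\<And>x. norm x < \<rho> \<Longrightarrow> continuous_on P (\<lambda>p. H p x)"
  shows "continuous_on (P \<times> {x. norm x < \<rho>}) (\<lambda>(p, x). H p x)"
    and "continuous_on (P \<times> {x. norm x < \<rho>} \<times> UNIV) (\<lambda>(p, x, y). frechet_derivative (H p) (at x) y)"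
proof -
  show joint: "continuous_on (P \<times> {x. norm x < \<rho>}) (\<lambda>(p, x). H p x)"
    unfolding continuous_on_def
  proof safe
    fix p0 :: 'p and x0 :: 'a assume p0: "p0 \<in> P" and x0: "norm x0 < \<rho>"
    obtain d where d: "0 < d" "norm x0 + d < \<rho>"
      using x0 dense[of 0 "\<rho> - norm x0"] by (auto simp: algebra_simps)
    let ?F = "at (p0, x0) within P \<times> {x. norm x < \<rho>}"
    let ?K = "2 * W (norm x0 + d) / d"
    have "continuous_on (P \<times> {x. norm x < \<rho>}) (\<lambda>z. H (fst z) x0)"
      by (rule continuous_on_compose2[OF cont[OF x0] continuous_on_fst]) (auto intro: continuous_on_id)
    then have A: "((\<lambda>z. H (fst z) x0) \<longlongrightarrow> H p0 x0) ?F"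
      using p0 x0 unfolding continuous_on_def by auto
    have snd0: "((\<lambda>z. snd z) \<longlongrightarrow> x0) ?F" by (auto intro!: tendsto_eq_intros)
    have "((\<lambda>z. ?K * norm (snd z - x0)) \<longlongrightarrow> ?K * norm (x0 - x0)) ?F"
      by (intro tendsto_intros snd0)
    then have K0: "((\<lambda>z. ?K * norm (snd z - x0)) \<longlongrightarrow> 0) ?F" by simp
    have "\<forall>\<^sub>F z in ?F. dist (snd z) x0 < d" using tendstoD[OF snd0 d(1)] .
    moreover have "\<forall>\<^sub>F z in ?F. fst z \<in> P" by (simp add: eventually_at_filter case_prod_unfold mem_Times_iff)
    ultimately have "\<forall>\<^sub>F z in ?F. norm (H (fst z) (snd z) - H (fst z) x0) \<le> ?K * norm (snd z - x0)"
    proof eventually_elim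
      case (elim z)
      then show ?case
        using cauchy_estimates_increment[OF ce[OF elim(2)] d, of "snd z"] W[of "norm x0 + d"] d
        by (simp add: dist_norm)
    qed
    then have "((\<lambda>z. H (fst z) (snd z) - H (fst z) x0) \<longlongrightarrow> 0) ?F"
      by (rule Lim_null_comparison[OF _ K0])
    from tendsto_add[OF this A] show "((\<lambda>(p, x). H p x) \<longlongrightarrow> H p0 x0) ?F"
      by (simp add: case_prod_unfold)
  qed
  let ?D = "\<lambda>(p, x, y). frechet_derivative (H p) (at x) y"
  have loc: "continuous_on (P \<times> {x. norm x < r} \<times> {y. norm y < s}) ?D" if r: "r < \<rho>" "0 < r" and s: "0 < s" for r s
  proof (rule uniform_limit_theorem)
    let ?A = "P \<times> {x::'a. norm x < r} \<times> {y::'a. norm y < s}"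
    let ?Q = "\<lambda>n (p, x, y). real n * (H p (x + (1 / real n) *\<^sub>R y) - H p x)"
    define d where "d = (\<rho> - r) / 2"
    have d: "0 < d" "r + d < \<rho>" using r by (auto simp: d_def field_simps)
    have "((\<lambda>n. s / real n) \<longlongrightarrow> 0) sequentially" by (rule lim_const_over_n)
    from order_tendstoD(2)[OF this d(1)]
    have ev: "\<forall>\<^sub>F n in sequentially. s / real n < d \<and> 0 < n" using eventually_gt_at_top[of 0] by eventually_elim auto
    have small: "norm ((1 / real n) *\<^sub>R y) < d" if "s / real n < d" "0 < n" "norm y < s" for n and y :: 'a
    proof -
      have "norm ((1 / real n) *\<^sub>R y) = norm y / real n" by simp
      also have "\<dots> < s / real n" using that by (intro divide_strict_right_mono) auto
      finally show ?thesis using that by simp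
    qed
    show "\<forall>\<^sub>F n in sequentially. continuous_on ?A (?Q n)"
      using ev
    proof eventually_elim
      case (elim n)
      have "continuous_on ?A (\<lambda>z. H (fst z) (fst (snd z) + (1 / real n) *\<^sub>R snd (snd z)))"
      proof (rule continuous_on_compose2[OF joint, of _ "\<lambda>z. (fst z, fst (snd z) + (1 / real n) *\<^sub>R snd (snd z))", simplified])
        show "continuous_on ?A (\<lambda>z. (fst z, fst (snd z) + (1 / real n) *\<^sub>R snd (snd z)))"
          by (intro continuous_intros)
        show "(\<lambda>z. (fst z, fst (snd z) + (1 / real n) *\<^sub>R snd (snd z))) ` ?A \<subseteq> P \<times> {x. norm x < \<rho>}"
        proof safe
          fix x y :: 'a assume "norm x < r" "norm y < s"
          then show "norm (fst (snd (p, x, y)) + (1 / real n) *\<^sub>R snd (snd (p, x, y))) < \<rho>" for p :: 'p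
            using norm_triangle_ineq[of x "(1 / real n) *\<^sub>R y"] small[of n y] elim d by simp
        qed auto
      qed
      moreover have "continuous_on ?A (\<lambda>z. H (fst z) (fst (snd z)))"
        by (rule continuous_on_compose2[OF joint, of _ "\<lambda>z. (fst z, fst (snd z))", simplified])
           (use r in \<open>auto intro!: continuous_intros\<close>)
      ultimately show ?case
        unfolding case_prod_unfold by (intro continuous_intros)
    qed
    show "uniform_limit ?A ?Q ?D sequentially"
    proof (rule uniform_limitI)
      fix e :: real assume e: "0 < e"
      let ?C = "W (r + d) * s\<^sup>2 / d\<^sup>2"
      have "((\<lambda>n. ?C / real n) \<longlongrightarrow> 0) sequentially" by (rule lim_const_over_n)
      from order_tendstoD(2)[OF this e] ev
      show "\<forall>\<^sub>F n in sequentially. \<forall>z\<in>?A. dist (?Q n z) (?D z) < e"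
      proof eventually_elim
        case (elim n)
        have "\<bar>real n * (H p (x + (1 / real n) *\<^sub>R y) - H p x) - frechet_derivative (H p) (at x) y\<bar> < e"
          if p: "p \<in> P" and x: "norm x < r" and y: "norm y < s" for p x y
        proof -
          let ?y = "(1 / real n) *\<^sub>R y" and ?L = "frechet_derivative (H p) (at x)"
          have xr: "norm x < \<rho>" "norm x + d < \<rho>" using x d by auto
          have "linear ?L"
            using ce[OF p] xr unfolding cauchy_estimates_def by (auto intro: linear_frechet_derivative)
          then have L: "?L y = real n * ?L ?y" using elim by (simp add: linear_scale)
          have "\<bar>H p (x + ?y) - H p x - ?L ?y\<bar> \<le> W (norm x + d) * (norm ?y / d)\<^sup>2"
            using ce[OF p] xr d small[of n y] elim y unfolding cauchy_estimates_def by (meson less_imp_le)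
          also have "\<dots> \<le> W (r + d) * (s / real n / d)\<^sup>2"
            using x y d elim W[of "r + d"] r
            by (intro mult_mono power_mono divide_right_mono W_mono) (auto simp: divide_right_mono)
          finally have "real n * \<bar>H p (x + ?y) - H p x - ?L ?y\<bar> \<le> real n * (W (r + d) * (s / real n / d)\<^sup>2)"
            by (intro mult_left_mono) auto
          also have "\<dots> = ?C / real n" using elim by (simp add: field_simps power2_eq_square)
          finally have "\<bar>real n * (H p (x + ?y) - H p x - ?L ?y)\<bar> < e"
            using elim by (simp add: abs_mult)
          then show ?thesis unfolding L by (simp add: right_diff_distrib)
        qed
        then show ?case by (auto simp: dist_real_def)
      qed
    qed
  qed auto
  show "continuous_on (P \<times> {x. norm x < \<rho>} \<times> UNIV) ?D"
    unfolding continuous_on_def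
  proof (intro ballI)
    fix z assume z: "z \<in> P \<times> {x :: 'a. norm x < \<rho>} \<times> (UNIV :: 'a set)"
    obtain p x y where zz: "z = (p, x, y)" by (cases z)
    have p: "p \<in> P" and x: "norm x < \<rho>" using z zz by auto
    obtain r where r: "norm x < r" "r < \<rho>" using x dense by blast
    define s where "s = norm y + 1"
    have s: "norm y < s" "0 < s" by (auto simp: s_def add_nonneg_pos)
    have r0: "0 < r" using r norm_ge_zero[of x] by linarith
    let ?N = "UNIV \<times> {x. norm x < r} \<times> {y. norm y < s} :: ('p \<times> 'a \<times> 'a) set"
    have "open ?N" by (intro open_Times open_UNIV) (auto intro!: open_Collect_less continuous_intros)
    moreover have "z \<in> ?N" using zz r s by simp
    ultimately have "at z within P \<times> {x. norm x < r} \<times> {y. norm y < s} = at z within P \<times> {x. norm x < \<rho>} \<times> UNIV"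
      using r by (intro at_within_nhd[of z ?N]) auto
    moreover have "(?D \<longlongrightarrow> ?D z) (at z within P \<times> {x. norm x < r} \<times> {y. norm y < s})"
      using loc[OF r(2) r0 s(2)] zz p r s unfolding continuous_on_def by blast
    ultimately show "(?D \<longlongrightarrow> ?D z) (at z within P \<times> {x. norm x < \<rho>} \<times> UNIV)" by simp
  qed
qed

section \<open>Iterated Lie derivatives as functions of the times\<close>

locale majorized_evolution =
  fixes v :: "real \<Rightarrow> 'a::banach \<Rightarrow> 'a" and g :: "'a \<Rightarrow> real"
    and \<rho> :: real and Y m :: "nat \<Rightarrow> real" and s t :: real
  assumes Y: "majorant \<rho> Y" and m: "majorant \<rho> m"
    and v: "\<And>r. r \<in> closed_segment s t \<Longrightarrow> majorized \<rho> Y (v r)" and g: "majorized \<rho> m g"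
    and v_cont: "continuous_on (closed_segment s t \<times> {x. norm x < \<rho>}) (\<lambda>(r, x). v r x)"
begin

definition iter_coeff :: "nat \<Rightarrow> nat \<Rightarrow> real" where
  "iter_coeff k = (lie_coeff Y ^^ k) m"

definition time_points :: "nat \<Rightarrow> (nat \<Rightarrow> real) set" where
  "time_points k = {\<tau>. \<forall>i\<in>{1..k}. \<tau> i \<in> closed_segment s t}"

lemma time_points_Suc: "\<tau> \<in> time_points (Suc k) \<longleftrightarrow> \<tau> \<in> time_points k \<and> \<tau> (Suc k) \<in> closed_segment s t"
  unfolding time_points_def by (auto simp: atLeastAtMostSuc_conv)

lemma iter_coeff_majorant: "majorant \<rho> (iter_coeff k)"
  unfolding iter_coeff_def by (induction k) (auto simp: m lie_coeff_power_sum(1)[OF Y])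

lemma lie_iter_majorized: "\<tau> \<in> time_points k \<Longrightarrow> majorized \<rho> (iter_coeff k) (lie_iter v \<tau> k g)"
proof (induction k)
  case 0
  then show ?case by (simp add: iter_coeff_def g)
next
  case (Suc k)
  have "majorized \<rho> (lie_coeff Y (iter_coeff k)) (lie (v (\<tau> (Suc k))) (lie_iter v \<tau> k g))"
    using Suc.prems by (intro majorized_lie Y iter_coeff_majorant v Suc.IH) (auto simp: time_points_Suc)
  then show ?case by (simp add: iter_coeff_def)
qed

lemma lie_iter_cauchy_estimates:
  "\<tau> \<in> time_points k \<Longrightarrow> cauchy_estimates \<rho> (power_sum (iter_coeff k)) (lie_iter v \<tau> k g)"
  by (rule majorized_cauchy_estimates[OF iter_coeff_majorant lie_iter_majorized])

lemma lie_iter_derivative_jointly_continuous: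
  assumes "\<And>x. norm x < \<rho> \<Longrightarrow> continuous_on (time_points k) (\<lambda>\<tau>. lie_iter v \<tau> k g x)"
  shows "continuous_on (time_points k \<times> {x. norm x < \<rho>} \<times> UNIV)
      (\<lambda>(\<tau>, x, y). frechet_derivative (lie_iter v \<tau> k g) (at x) y)"
  by (rule cauchy_estimates_parametric_continuous(2)[OF lie_iter_cauchy_estimates
        power_sum_nonneg[OF iter_coeff_majorant] power_sum_mono[OF iter_coeff_majorant] assms])

text \<open>
  Although the vector field is continuous in time only pointwise, no continuity in time is lost
  by taking Lie derivatives, thanks to the uniform Cauchy estimates.
\<close>
lemma lie_iter_continuous:
  "norm x < \<rho> \<Longrightarrow> continuous_on (time_points k) (\<lambda>\<tau>. lie_iter v \<tau> k g x)"
proof (induction k arbitrary: x)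
  case 0
  then show ?case by simp
next
  case (Suc k)
  have sub: "time_points (Suc k) \<subseteq> time_points k" by (auto simp: time_points_Suc)
  have coord: "continuous_on (time_points (Suc k)) (\<lambda>\<tau>. \<tau> (Suc k))"
    by (rule continuous_on_subset[OF continuous_on_product_coordinates]) simp
  have v_time: "continuous_on (time_points (Suc k)) (\<lambda>\<tau>. v (\<tau> (Suc k)) x)"
    by (rule continuous_on_compose2[OF v_cont, of _ "\<lambda>\<tau>. (\<tau> (Suc k), x)", simplified])
       (use Suc.prems in \<open>auto simp: time_points_Suc intro!: continuous_intros coord\<close>)
  have "continuous_on (time_points (Suc k)) (\<lambda>\<tau>. frechet_derivative (lie_iter v \<tau> k g) (at x) (v (\<tau> (Suc k)) x))"
    by (rule continuous_on_compose2[OF lie_iter_derivative_jointly_continuous[OF Suc.IH],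
          of _ "\<lambda>\<tau>. (\<tau>, x, v (\<tau> (Suc k)) x)", simplified])
       (use Suc.prems sub in \<open>auto intro!: continuous_intros v_time\<close>)
  then show ?case by (simp add: lie_def)
qed

lemma lie_iter_derivative_continuous:
  assumes "norm x < \<rho>"
  shows "continuous_on (time_points k) (\<lambda>\<tau>. frechet_derivative (lie_iter v \<tau> k g) (at x) y)"
  by (rule continuous_on_compose2[OF lie_iter_derivative_jointly_continuous[OF lie_iter_continuous],
        of _ "\<lambda>\<tau>. (\<tau>, x, y)", simplified])
     (use assms in \<open>auto intro!: continuous_intros\<close>)

end

section \<open>Integration over the time simplex\<close>

abbreviation lborel_pow :: "nat \<Rightarrow> (nat \<Rightarrow> real) measure" where
  "lborel_pow k \<equiv> Pi\<^sub>M {1..k} (\<lambda>_. lborel)"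

text \<open>A description that does not distinguish the two orders of the endpoints.\<close>
lemma mem_time_simplex:
  "\<tau> \<in> time_simplex k s t \<longleftrightarrow>
     (\<forall>i\<in>{1..k}. \<tau> i \<in> open_segment s t) \<and>
     (\<forall>i\<in>{1..k}. \<forall>j\<in>{1..k}. i < j \<longrightarrow> \<tau> i \<in> open_segment s (\<tau> j))"
proof (cases "s \<le> t")
  case True
  then have "\<tau> \<in> time_simplex k s t \<longleftrightarrow> (\<forall>i\<in>{1..k}. s < \<tau> i \<and> \<tau> i < t) \<and>
      (\<forall>i\<in>{1..k}. \<forall>j\<in>{1..k}. i < j \<longrightarrow> \<tau> i < \<tau> j)"
    unfolding time_simplex_def by (auto simp: strict_mono_on_def)
  with True show ?thesis by (auto simp: open_segment_eq_real_ivl)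
next
  case False
  then have "\<tau> \<in> time_simplex k s t \<longleftrightarrow> (\<forall>i\<in>{1..k}. t < \<tau> i \<and> \<tau> i < s) \<and>
      (\<forall>i\<in>{1..k}. \<forall>j\<in>{1..k}. i < j \<longrightarrow> \<tau> j < \<tau> i)"
    unfolding time_simplex_def by (auto simp: monotone_on_def)
  with False show ?thesis by (auto simp: open_segment_eq_real_ivl)
qed

text \<open>
  The last time runs through the whole interval, and the other ones through the simplex that ends at
  it.  This is the recursion behind the volume and behind Fubini's theorem below.
\<close>
lemma time_simplex_Suc_fun_upd:
  "\<tau>(Suc k := r) \<in> time_simplex (Suc k) s t \<longleftrightarrow> r \<in> open_segment s t \<and> \<tau> \<in> time_simplex k s r"
proof -
  have "x \<in> open_segment s t" if "x \<in> open_segment s r" "r \<in> open_segment s t" for x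
    using that by (auto simp: open_segment_eq_real_ivl split: if_splits)
  then show ?thesis
    unfolding mem_time_simplex by (auto simp: atLeastAtMostSuc_conv)
qed

lemma time_simplex_sets: "{\<tau> \<in> space (lborel_pow k). \<tau> \<in> time_simplex k s t} \<in> sets (lborel_pow k)"
proof -
  have coord [measurable]: "(\<lambda>\<tau>. \<tau> i) \<in> borel_measurable (lborel_pow k)" if "i \<in> {1..k}" for i
    using measurable_component_singleton[OF that, of "\<lambda>_. lborel"] by simp
  have seg: "a \<in> open_segment s b \<longleftrightarrow> s < a \<and> a < b \<or> b < a \<and> a < s" for a b :: real
    by (auto simp: open_segment_eq_real_ivl)
  have "Measurable.pred (lborel_pow k) (\<lambda>\<tau>. \<tau> i \<in> open_segment s t)" if "i \<in> {1..k}" for i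
    unfolding seg
    by (intro pred_intros_logic borel_measurable_pred_less borel_measurable_const coord that)
  moreover have "Measurable.pred (lborel_pow k) (\<lambda>\<tau>. \<tau> i \<in> open_segment s (\<tau> j))"
    if "i \<in> {1..k}" "j \<in> {1..k}" for i j
    unfolding seg
    by (intro pred_intros_logic borel_measurable_pred_less borel_measurable_const coord that)
  ultimately have "Measurable.pred (lborel_pow k) (\<lambda>\<tau>. \<tau> \<in> time_simplex k s t)"
    unfolding mem_time_simplex
    by (intro pred_intros_logic(3) pred_intros_finite pred_intros_imp' finite_atLeastAtMost)
  then show ?thesis by (simp add: pred_def)
qed

lemma time_simplex_volume_le:
  "(\<integral>\<^sup>+\<tau>. indicator (time_simplex k s t) \<tau> \<partial>lborel_pow k) \<le> ennreal (\<bar>t - s\<bar> ^ k / fact k)"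
proof (induction k arbitrary: t)
  case 0
  interpret product_sigma_finite "\<lambda>_::nat. lborel :: real measure" ..
  show ?case by (simp add: time_simplex_def PiM_empty)
next
  case (Suc k)
  interpret product_sigma_finite "\<lambda>_::nat. lborel :: real measure" ..
  have ins: "{1..Suc k} = insert (Suc k) {1..k}" by auto
  have meas: "(\<lambda>\<tau>. indicator (time_simplex (Suc k) s t) \<tau> :: ennreal) \<in> borel_measurable (lborel_pow (Suc k))"
  proof -
    have "(\<lambda>\<tau>. indicator {\<tau> \<in> space (lborel_pow (Suc k)). \<tau> \<in> time_simplex (Suc k) s t} \<tau> :: ennreal)
        \<in> borel_measurable (lborel_pow (Suc k))"
      using time_simplex_sets by (intro borel_measurable_indicator)
    then show ?thesis by (rule measurable_cong[THEN iffD1, rotated]) (auto simp: indicator_def)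
  qed
  have "(\<integral>\<^sup>+\<tau>. indicator (time_simplex (Suc k) s t) \<tau> \<partial>lborel_pow (Suc k))
      = (\<integral>\<^sup>+r. \<integral>\<^sup>+\<tau>. indicator (time_simplex (Suc k) s t) (\<tau>(Suc k := r)) \<partial>lborel_pow k \<partial>lborel)"
    using meas unfolding ins by (intro product_nn_integral_insert_rev) auto
  also have "\<dots> = (\<integral>\<^sup>+r. (\<integral>\<^sup>+\<tau>. indicator (time_simplex k s r) \<tau> \<partial>lborel_pow k) * indicator (open_segment s t) r \<partial>lborel)"
    by (intro nn_integral_cong)
       (auto simp: indicator_def time_simplex_Suc_fun_upd intro!: nn_integral_cong split: if_splits)
  also have "\<dots> \<le> (\<integral>\<^sup>+r. ennreal (\<bar>r - s\<bar> ^ k / fact k) * indicator (closed_segment s t) r \<partial>lborel)"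
    using segment_open_subset_closed[of s t]
    by (intro nn_integral_mono mult_mono Suc.IH) (auto simp: indicator_def)
  also have "\<dots> = ennreal (\<bar>t - s\<bar> ^ Suc k / fact (Suc k))"
  proof -
    have fact_eq: "(1 + real k) * x / fact (Suc k) = x / fact k" for x :: real
      by (simp add: fact_Suc divide_simps)
    show ?thesis
    proof (cases "s \<le> t")
      case True
      have "(\<integral>\<^sup>+r. ennreal (\<bar>r - s\<bar> ^ k / fact k) * indicator {s..t} r \<partial>lborel)
          = ennreal ((t - s) ^ Suc k / fact (Suc k) - (s - s) ^ Suc k / fact (Suc k))"
      proof (rule nn_integral_FTC_Icc[OF _ _ _ True])
        fix r assume r: "r \<in> {s..t}"
        have "((\<lambda>r. r - s) has_real_derivative 1) (at r)" by (auto intro!: derivative_eq_intros)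
        from DERIV_cdivide[OF DERIV_power_Suc[OF this, of k], of "fact (Suc k)"]
        have "((\<lambda>r. (r - s) ^ Suc k / fact (Suc k)) has_real_derivative (r - s) ^ k / fact k) (at r)"
          by (simp only: fact_eq mult_1)
        then show "((\<lambda>r. (r - s) ^ Suc k / fact (Suc k)) has_real_derivative \<bar>r - s\<bar> ^ k / fact k) (at r)"
          using r by simp
      qed auto
      then show ?thesis using True by (simp add: closed_segment_eq_real_ivl)
    next
      case False
      have "(\<integral>\<^sup>+r. ennreal (\<bar>r - s\<bar> ^ k / fact k) * indicator {t..s} r \<partial>lborel)
          = ennreal (- ((s - s) ^ Suc k / fact (Suc k)) - - ((s - t) ^ Suc k / fact (Suc k)))"
      proof (rule nn_integral_FTC_Icc)
        show "t \<le> s" using False by simp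
        fix r assume r: "r \<in> {t..s}"
        have "((\<lambda>r. s - r) has_real_derivative - 1) (at r)" by (auto intro!: derivative_eq_intros)
        from DERIV_minus[OF DERIV_cdivide[OF DERIV_power_Suc[OF this, of k], of "fact (Suc k)"]]
        have "((\<lambda>r. - ((s - r) ^ Suc k / fact (Suc k))) has_real_derivative (s - r) ^ k / fact k) (at r)"
          by (simp only: fact_eq mult_minus1 mult_minus_right minus_divide_left[symmetric] minus_minus)
        then show "((\<lambda>r. - ((s - r) ^ Suc k / fact (Suc k))) has_real_derivative \<bar>r - s\<bar> ^ k / fact k) (at r)"
          using r by (simp add: abs_minus_commute)
      qed auto
      then show ?thesis using False by (simp add: closed_segment_eq_real_ivl)
    qed
  qed
  finally show ?case .
qed

lemma simplex_integral_Suc: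
  fixes c :: "(nat \<Rightarrow> real) \<Rightarrow> real"
  assumes "set_integrable (lborel_pow (Suc k)) (time_simplex (Suc k) s t) c"
  shows "(LINT \<tau>:time_simplex (Suc k) s t|lborel_pow (Suc k). c \<tau>) =
         (LINT r:open_segment s t|lborel. LINT \<tau>:time_simplex k s r|lborel_pow k. c (\<tau>(Suc k := r)))"
proof -
  interpret product_sigma_finite "\<lambda>_::nat. lborel :: real measure" ..
  let ?f = "\<lambda>\<tau>. indicator (time_simplex (Suc k) s t) \<tau> *\<^sub>R c \<tau>"
  let ?B = "Pi\<^sub>M {Suc k} (\<lambda>_. lborel :: real measure)"
  interpret finite_product_sigma_finite "\<lambda>_::nat. lborel :: real measure" "{1..k}" by standard simp
  have ins: "{1..Suc k} = {Suc k} \<union> {1..k}" by auto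
  have int: "integrable (Pi\<^sub>M ({Suc k} \<union> {1..k}) (\<lambda>_. lborel)) ?f"
    using assms unfolding set_integrable_def ins .
  have fm: "?f \<in> borel_measurable (Pi\<^sub>M (insert (Suc k) {1..k}) (\<lambda>_. lborel))"
    using borel_measurable_integrable[OF int] by simp
  have "(\<lambda>z. (snd z)(Suc k := fst z)) \<in> measurable (lborel \<Otimes>\<^sub>M lborel_pow k)
      (Pi\<^sub>M (insert (Suc k) {1..k}) (\<lambda>_. lborel))"
    by (rule measurable_fun_upd[where J="{1..k}"]) auto
  from measurable_compose[OF this fm]
  have inner_meas: "(\<lambda>r. \<integral>y. ?f (y(Suc k := r)) \<partial>lborel_pow k) \<in> borel_measurable lborel"
    by (intro borel_measurable_lebesgue_integral) (simp add: case_prod_unfold)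
  have "integral\<^sup>L (lborel_pow (Suc k)) ?f
      = (\<integral>x. (\<integral>y. ?f (merge {Suc k} {1..k} (x, y)) \<partial>lborel_pow k) \<partial>?B)"
    unfolding ins by (rule product_integral_fold) (use int in auto)
  also have "\<dots> = (\<integral>x. (\<integral>y. ?f (y(Suc k := x (Suc k))) \<partial>lborel_pow k) \<partial>?B)"
  proof (intro Bochner_Integration.integral_cong refl arg_cong[where f="?f"])
    fix x y assume "x \<in> space ?B" "y \<in> space (lborel_pow k)"
    then show "merge {Suc k} {1..k} (x, y) = y(Suc k := x (Suc k))"
      by (auto simp: merge_def space_PiM PiE_def extensional_def fun_eq_iff)
  qed
  also have "\<dots> = (\<integral>r. (\<integral>y. ?f (y(Suc k := r)) \<partial>lborel_pow k) \<partial>lborel)"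
    by (rule product_integral_singleton[of "\<lambda>r. \<integral>y. ?f (y(Suc k := r)) \<partial>lborel_pow k" "Suc k"])
       (use inner_meas in simp)
  also have "\<dots> = (\<integral>r. indicator (open_segment s t) r *\<^sub>R
      (\<integral>\<tau>. indicator (time_simplex k s r) \<tau> *\<^sub>R c (\<tau>(Suc k := r)) \<partial>lborel_pow k) \<partial>lborel)"
    by (intro Bochner_Integration.integral_cong refl) (auto simp: indicator_def time_simplex_Suc_fun_upd)
  finally show ?thesis unfolding set_lebesgue_integral_def .
qed

context majorized_evolution
begin

lemma time_simplex_subset_time_points:
  assumes "r \<in> closed_segment s t"
  shows "time_simplex k s r \<subseteq> time_points k"
proof -
  have "open_segment s r \<subseteq> closed_segment s r" by (rule segment_open_subset_closed)
  also have "\<dots> \<subseteq> closed_segment s t"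
    by (rule closed_segment_subset[OF ends_in_segment(1) assms convex_closed_segment])
  finally show ?thesis by (auto simp: mem_time_simplex time_points_def)
qed

text \<open>
  The Borel sets of the product topology on \<open>nat \<Rightarrow> real\<close> are generated by the coordinates.  On the
  space of the finite product measure all but finitely many coordinates are constant, so the identity
  is measurable from there, and continuity of \<open>c\<close> gives measurability.
\<close>
lemma simplex_integral_bound:
  fixes c :: "(nat \<Rightarrow> real) \<Rightarrow> real"
  assumes c: "continuous_on (time_points k) c" and B: "\<And>\<tau>. \<tau> \<in> time_points k \<Longrightarrow> \<bar>c \<tau>\<bar> \<le> B" "0 \<le> B"
    and r: "r \<in> closed_segment s t"
  shows "set_integrable (lborel_pow k) (time_simplex k s r) c"
    and "\<bar>LINT \<tau>:time_simplex k s r|lborel_pow k. c \<tau>\<bar> \<le> \<bar>r - s\<bar> ^ k / fact k * B"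
proof -
  let ?S = "{\<tau> \<in> space (lborel_pow k). \<tau> \<in> time_simplex k s r}"
  let ?f = "\<lambda>\<tau>. indicator (time_simplex k s r) \<tau> *\<^sub>R c \<tau>"
  have "time_points k = (\<Inter>i\<in>{1..k}. (\<lambda>\<tau>. \<tau> i) -` closed_segment s t)" by (auto simp: time_points_def)
  moreover have "closed \<dots>"
    by (intro closed_INT ballI closed_vimage closed_segment continuous_on_product_coordinates)
  ultimately have "time_points k \<in> sets borel" by simp
  then have "(\<lambda>\<tau>. indicator (time_points k) \<tau> *\<^sub>R c \<tau>) \<in> borel_measurable borel"
    using c by (rule borel_measurable_continuous_on_indicator)
  moreover have "(\<lambda>\<tau>. \<tau>) \<in> borel_measurable (lborel_pow k)"
  proof (rule measurable_coordinatewise_then_product)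
    fix i :: nat
    show "(\<lambda>\<tau>. \<tau> i) \<in> borel_measurable (lborel_pow k)"
    proof (cases "i \<in> {1..k}")
      case True
      then show ?thesis using measurable_component_singleton[OF True, of "\<lambda>_. lborel"] by simp
    next
      case False
      have "(\<lambda>\<tau>. undefined :: real) \<in> borel_measurable (lborel_pow k)" by simp
      then show ?thesis
        by (rule measurable_cong[THEN iffD1, rotated])
           (use False in \<open>auto simp: space_PiM PiE_def extensional_def\<close>)
    qed
  qed
  ultimately have c_meas: "(\<lambda>\<tau>. indicator (time_points k) \<tau> *\<^sub>R c \<tau>) \<in> borel_measurable (lborel_pow k)"
    by (rule measurable_compose[rotated])
  have "(\<lambda>\<tau>. indicator ?S \<tau> *\<^sub>R (indicator (time_points k) \<tau> *\<^sub>R c \<tau>)) \<in> borel_measurable (lborel_pow k)"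
    by (intro borel_measurable_scaleR borel_measurable_indicator time_simplex_sets c_meas)
  then have f_meas: "?f \<in> borel_measurable (lborel_pow k)"
    by (rule measurable_cong[THEN iffD1, rotated])
       (use time_simplex_subset_time_points[OF r] in \<open>auto simp: indicator_def\<close>)
  have "(\<integral>\<^sup>+\<tau>. ennreal (norm (?f \<tau>)) \<partial>lborel_pow k)
      \<le> (\<integral>\<^sup>+\<tau>. ennreal B * indicator (time_simplex k s r) \<tau> \<partial>lborel_pow k)"
    using B time_simplex_subset_time_points[OF r] by (intro nn_integral_mono) (auto simp: indicator_def)
  also have "\<dots> = ennreal B * (\<integral>\<^sup>+\<tau>. indicator (time_simplex k s r) \<tau> \<partial>lborel_pow k)"
  proof (rule nn_integral_cmult)
    have "(\<lambda>\<tau>. indicator ?S \<tau> :: ennreal) \<in> borel_measurable (lborel_pow k)"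
      by (intro borel_measurable_indicator time_simplex_sets)
    then show "(\<lambda>\<tau>. indicator (time_simplex k s r) \<tau> :: ennreal) \<in> borel_measurable (lborel_pow k)"
      by (rule measurable_cong[THEN iffD1, rotated]) (auto simp: indicator_def)
  qed
  also have "\<dots> \<le> ennreal B * ennreal (\<bar>r - s\<bar> ^ k / fact k)"
    by (intro mult_left_mono time_simplex_volume_le) auto
  also have "\<dots> = ennreal (\<bar>r - s\<bar> ^ k / fact k * B)"
    using B(2) by (simp add: ennreal_mult'[symmetric] mult.commute)
  finally have le: "(\<integral>\<^sup>+\<tau>. ennreal (norm (?f \<tau>)) \<partial>lborel_pow k) \<le> ennreal (\<bar>r - s\<bar> ^ k / fact k * B)" .
  then have int: "integrable (lborel_pow k) ?f"
    by (intro integrableI_bounded f_meas) (auto intro: le_less_trans)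
  then show "set_integrable (lborel_pow k) (time_simplex k s r) c" unfolding set_integrable_def .
  have "ennreal (norm (integral\<^sup>L (lborel_pow k) ?f)) \<le> ennreal (\<bar>r - s\<bar> ^ k / fact k * B)"
    using integral_norm_bound_ennreal[OF int] le by (rule order_trans)
  then show "\<bar>LINT \<tau>:time_simplex k s r|lborel_pow k. c \<tau>\<bar> \<le> \<bar>r - s\<bar> ^ k / fact k * B"
    using B(2) unfolding set_lebesgue_integral_def by (simp add: ennreal_le_iff)
qed

end

section \<open>The terms of the chronological exponential\<close>

lemma cauchy_estimates_mono:
  assumes "cauchy_estimates \<rho> W h" "\<And>z. 0 \<le> z \<Longrightarrow> z < \<rho> \<Longrightarrow> W z \<le> W' z"
  shows "cauchy_estimates \<rho> W' h"
  unfolding cauchy_estimates_def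
proof (intro allI impI conjI)
  fix x :: 'a assume x: "norm x < \<rho>"
  note est = assms(1)[unfolded cauchy_estimates_def, rule_format, OF x]
  show "h differentiable (at x)" using est by blast
  show "\<bar>h x\<bar> \<le> W' (norm x)" using est assms(2)[OF norm_ge_zero x] by linarith
  fix d :: real assume d: "0 < d" "norm x + d < \<rho>"
  have WW: "W (norm x + d) \<le> W' (norm x + d)" using d by (intro assms(2)) auto
  fix y
  have "\<bar>frechet_derivative h (at x) y\<bar> \<le> W (norm x + d) / d * norm y" using est d by blast
  also have "\<dots> \<le> W' (norm x + d) / d * norm y"
    using WW d by (intro mult_right_mono divide_right_mono) auto
  finally show "\<bar>frechet_derivative h (at x) y\<bar> \<le> W' (norm x + d) / d * norm y" .
  assume y: "norm y \<le> d"
  have "\<bar>h (x + y) - h x - frechet_derivative h (at x) y\<bar> \<le> W (norm x + d) * (norm y / d)\<^sup>2"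
    using est d y by blast
  also have "\<dots> \<le> W' (norm x + d) * (norm y / d)\<^sup>2" using WW by (intro mult_right_mono) auto
  finally show "\<bar>h (x + y) - h x - frechet_derivative h (at x) y\<bar> \<le> W' (norm x + d) * (norm y / d)\<^sup>2" .
qed

lemma set_integral_cong_on:
  "(\<And>x. x \<in> A \<Longrightarrow> f x = h x) \<Longrightarrow> (LINT x:A|M. f x) = (LINT x:A|M. h x :: real)"
  unfolding set_lebesgue_integral_def by (intro Bochner_Integration.integral_cong refl) (auto simp: indicator_def)

lemma lie_iter_fun_upd: "k < j \<Longrightarrow> lie_iter v (\<tau>(j := r)) k g = lie_iter v \<tau> k g"
  by (induction k) auto

definition orientation :: "nat \<Rightarrow> real \<Rightarrow> real \<Rightarrow> real" where
  "orientation k s t = (if s \<le> t then 1 else (- 1) ^ k)"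

lemma abs_orientation [simp]: "\<bar>orientation k s t\<bar> = 1"
  by (simp add: orientation_def)

context majorized_evolution
begin

abbreviation term_at :: "nat \<Rightarrow> real \<Rightarrow> 'a \<Rightarrow> real" where
  "term_at k r \<equiv> (\<lambda>x. chron_term v s r g x k)"

abbreviation volume :: "nat \<Rightarrow> real \<Rightarrow> real" where
  "volume k r \<equiv> \<bar>r - s\<bar> ^ k / fact k"

lemma term_at_eq:
  "term_at k r x = orientation k s r * (LINT \<tau>:time_simplex k s r|lborel_pow k. lie_iter v \<tau> k g x)"
  by (simp add: chron_term_def orientation_def)

lemma lie_iter_estimates:
  assumes "\<tau> \<in> time_points k"
  shows "norm x < \<rho> \<Longrightarrow> linear (frechet_derivative (lie_iter v \<tau> k g) (at x))"
    and "norm x < \<rho> \<Longrightarrow> \<bar>lie_iter v \<tau> k g x\<bar> \<le> power_sum (iter_coeff k) (norm x)"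
    and "0 < d \<Longrightarrow> norm x + d < \<rho> \<Longrightarrow>
      \<bar>frechet_derivative (lie_iter v \<tau> k g) (at x) y\<bar> \<le> power_sum (iter_coeff k) (norm x + d) / d * norm y"
    and "0 < d \<Longrightarrow> norm x + d < \<rho> \<Longrightarrow> norm y \<le> d \<Longrightarrow>
      \<bar>lie_iter v \<tau> k g (x + y) - lie_iter v \<tau> k g x - frechet_derivative (lie_iter v \<tau> k g) (at x) y\<bar>
        \<le> power_sum (iter_coeff k) (norm x + d) * (norm y / d)\<^sup>2"
proof -
  have lt: "norm x < \<rho>" if "0 < d" "norm x + d < \<rho>" using that by simp
  note est = lie_iter_cauchy_estimates[OF assms, unfolded cauchy_estimates_def]
  show "linear (frechet_derivative (lie_iter v \<tau> k g) (at x))" if "norm x < \<rho>"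
    using est that by (intro linear_frechet_derivative) blast
  show "norm x < \<rho> \<Longrightarrow> \<bar>lie_iter v \<tau> k g x\<bar> \<le> power_sum (iter_coeff k) (norm x)"
    using est by blast
  show "0 < d \<Longrightarrow> norm x + d < \<rho> \<Longrightarrow>
      \<bar>frechet_derivative (lie_iter v \<tau> k g) (at x) y\<bar> \<le> power_sum (iter_coeff k) (norm x + d) / d * norm y"
    using est lt by blast
  show "0 < d \<Longrightarrow> norm x + d < \<rho> \<Longrightarrow> norm y \<le> d \<Longrightarrow>
      \<bar>lie_iter v \<tau> k g (x + y) - lie_iter v \<tau> k g x - frechet_derivative (lie_iter v \<tau> k g) (at x) y\<bar>
        \<le> power_sum (iter_coeff k) (norm x + d) * (norm y / d)\<^sup>2"
    using est lt by blast
qed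

lemma lie_iter_set_integrable:
  assumes r: "r \<in> closed_segment s t" and x: "norm x < \<rho>"
  shows "set_integrable (lborel_pow k) (time_simplex k s r) (\<lambda>\<tau>. lie_iter v \<tau> k g x)"
  by (rule simplex_integral_bound(1)[OF lie_iter_continuous[OF x] lie_iter_estimates(2)[OF _ x] _ r])
     (use power_sum_nonneg[OF iter_coeff_majorant] x in auto)

lemma lie_iter_derivative_set_integrable:
  assumes r: "r \<in> closed_segment s t" and x: "norm x < \<rho>"
  shows "set_integrable (lborel_pow k) (time_simplex k s r)
    (\<lambda>\<tau>. frechet_derivative (lie_iter v \<tau> k g) (at x) y)"
proof -
  obtain d where d: "0 < d" "norm x + d < \<rho>"
    using x dense[of 0 "\<rho> - norm x"] by (auto simp: algebra_simps)
  show ?thesis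
    by (rule simplex_integral_bound(1)[OF lie_iter_derivative_continuous[OF x] lie_iter_estimates(3)[OF _ d] _ r])
       (use power_sum_nonneg[OF iter_coeff_majorant] d in auto)
qed

text \<open>
  The Cauchy estimates are inequalities between quantities that are linear in the iterate, with bounds
  independent of the times; integration multiplies the bounds by the volume of the simplex and shows
  that the derivative may be taken under the integral.
\<close>
lemma term_at_estimates:
  assumes r: "r \<in> closed_segment s t"
  shows "cauchy_estimates \<rho> (\<lambda>z. volume k r * power_sum (iter_coeff k) z) (term_at k r)"
    and "\<And>x y. norm x < \<rho> \<Longrightarrow> frechet_derivative (term_at k r) (at x) y =
      orientation k s r * (LINT \<tau>:time_simplex k s r|lborel_pow k. frechet_derivative (lie_iter v \<tau> k g) (at x) y)"
proof -
  let ?I = "\<lambda>c. LINT \<tau>:time_simplex k s r|lborel_pow k. c \<tau>"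
  let ?D = "\<lambda>\<tau> x y. frechet_derivative (lie_iter v \<tau> k g) (at x) y"
  define D where "D x y = orientation k s r * ?I (\<lambda>\<tau>. ?D \<tau> x y)" for x y
  note sub = time_simplex_subset_time_points[OF r, THEN subsetD]
  note P0 = power_sum_nonneg[OF iter_coeff_majorant]
  have lin: "linear (D x)" if x: "norm x < \<rho>" for x
  proof
    note lin1 = lie_iter_estimates(1)[OF sub x]
    note int = lie_iter_derivative_set_integrable[OF r x]
    fix y z and c :: real
    have "?I (\<lambda>\<tau>. ?D \<tau> x (y + z)) = ?I (\<lambda>\<tau>. ?D \<tau> x y + ?D \<tau> x z)"
      by (intro set_integral_cong_on linear_add lin1)
    also have "\<dots> = ?I (\<lambda>\<tau>. ?D \<tau> x y) + ?I (\<lambda>\<tau>. ?D \<tau> x z)"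
      by (rule set_integral_add(2)[OF int int])
    finally show "D x (y + z) = D x y + D x z"
      unfolding D_def by (simp only: distrib_left)
    have "?I (\<lambda>\<tau>. ?D \<tau> x (c *\<^sub>R y)) = ?I (\<lambda>\<tau>. c * ?D \<tau> x y)"
      by (rule set_integral_cong_on) (simp add: linear_scale[OF lin1])
    then show "D x (c *\<^sub>R y) = c *\<^sub>R D x y" unfolding D_def by simp
  qed
  have val: "\<bar>term_at k r x\<bar> \<le> volume k r * power_sum (iter_coeff k) (norm x)" if x: "norm x < \<rho>" for x
    using simplex_integral_bound(2)[OF lie_iter_continuous[OF x] lie_iter_estimates(2)[OF _ x] _ r] P0 x
    by (simp add: term_at_eq abs_mult)
  have der: "\<bar>D x y\<bar> \<le> volume k r * power_sum (iter_coeff k) (norm x + d) / d * norm y"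
    if d: "0 < d" "norm x + d < \<rho>" for x d y
  proof -
    have x: "norm x < \<rho>" using d by simp
    have "0 \<le> power_sum (iter_coeff k) (norm x + d) / d * norm y"
      using P0[of "norm x + d"] d by simp
    from simplex_integral_bound(2)[OF lie_iter_derivative_continuous[OF x] lie_iter_estimates(3)[OF _ d] this r]
    show ?thesis by (simp add: D_def abs_mult)
  qed
  have rem: "\<bar>term_at k r (x + y) - term_at k r x - D x y\<bar>
      \<le> volume k r * power_sum (iter_coeff k) (norm x + d) * (norm y / d)\<^sup>2"
    if d: "0 < d" "norm x + d < \<rho>" "norm y \<le> d" for x d y
  proof -
    have x: "norm x < \<rho>" and xy: "norm (x + y) < \<rho>" using d norm_triangle_ineq[of x y] by auto
    let ?R = "\<lambda>\<tau>. lie_iter v \<tau> k g (x + y) - lie_iter v \<tau> k g x - ?D \<tau> x y"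
    note int = lie_iter_set_integrable[OF r xy] lie_iter_set_integrable[OF r x]
      lie_iter_derivative_set_integrable[OF r x]
    have eq: "term_at k r (x + y) - term_at k r x - D x y = orientation k s r * ?I ?R"
      unfolding term_at_eq D_def
      by (simp only: set_integral_diff(2)[OF set_integral_diff(1)[OF int(1,2)] int(3)]
          set_integral_diff(2)[OF int(1,2)] right_diff_distrib)
    have "continuous_on (time_points k) ?R"
      by (intro continuous_on_diff lie_iter_continuous lie_iter_derivative_continuous x xy)
    moreover have "0 \<le> power_sum (iter_coeff k) (norm x + d) * (norm y / d)\<^sup>2"
      using P0[of "norm x + d"] d by simp
    ultimately have "\<bar>?I ?R\<bar> \<le> volume k r * (power_sum (iter_coeff k) (norm x + d) * (norm y / d)\<^sup>2)"
      by (intro simplex_integral_bound(2)[OF _ _ _ r] lie_iter_estimates(4) d)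
    then show ?thesis unfolding eq by (simp add: abs_mult)
  qed
  show "cauchy_estimates \<rho> (\<lambda>z. volume k r * power_sum (iter_coeff k) z) (term_at k r)"
    by (rule cauchy_estimatesI(1)[OF lin val der rem])
  show "frechet_derivative (term_at k r) (at x) y = orientation k s r * ?I (\<lambda>\<tau>. ?D \<tau> x y)"
    if "norm x < \<rho>" for x y
    using frechet_derivative_at[OF cauchy_estimatesI(2)[OF lin val der rem that], symmetric]
    by (simp add: D_def)
qed

lemma term_at_0: "term_at 0 r x = g x"
  by (simp add: chron_term_def time_simplex_def set_lebesgue_integral_def PiM_empty
      lebesgue_integral_count_space_finite)

text \<open>
  Fubini's theorem with the last time outside.  The inner integral is that of the differential of the
  \<open>k\<close>-fold iterate, that is, the differential of the term of order \<open>k\<close>; the sign that is gained for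
  \<open>r < s\<close> is that of the oriented integral.
\<close>
lemma term_at_Suc:
  assumes r: "r \<in> closed_segment s t" and x: "norm x < \<rho>"
  shows "term_at (Suc k) r x = (LBINT q=s..r. lie (v q) (term_at k q) x)"
proof -
  let ?J = "\<lambda>q. LINT \<tau>:time_simplex k s q|lborel_pow k. frechet_derivative (lie_iter v \<tau> k g) (at x) (v q x)"
  have seg: "open_segment s r \<subseteq> closed_segment s t"
    using segment_open_subset_closed closed_segment_subset[OF ends_in_segment(1) r convex_closed_segment]
    by blast
  have "(LINT \<tau>:time_simplex (Suc k) s r|lborel_pow (Suc k). lie_iter v \<tau> (Suc k) g x)
      = (LINT q:open_segment s r|lborel. ?J q)"
    unfolding simplex_integral_Suc[OF lie_iter_set_integrable[OF r x]]
    by (simp add: lie_iter_fun_upd lie_def)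
  also have "\<dots> = (LINT q:open_segment s r|lborel. orientation k s r * lie (v q) (term_at k q) x)"
  proof (rule set_integral_cong_on)
    fix q assume q: "q \<in> open_segment s r"
    then have "orientation k s q = orientation k s r"
      by (auto simp: orientation_def open_segment_eq_real_ivl split: if_splits)
    moreover have "orientation k s r * orientation k s r = 1"
      by (simp add: orientation_def power_mult_distrib[symmetric])
    ultimately show "?J q = orientation k s r * lie (v q) (term_at k q) x"
      using seg q x by (simp add: lie_def term_at_estimates(2) mult.assoc[symmetric] subset_iff)
  qed
  finally have "term_at (Suc k) r x = orientation (Suc k) s r * (orientation k s r *
      (LINT q:open_segment s r|lborel. lie (v q) (term_at k q) x))"
    by (simp add: term_at_eq)
  then show ?thesis
    by (auto simp: interval_lebesgue_integral_def orientation_def open_segment_eq_real_ivl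
        power_mult_distrib[symmetric] mult.assoc[symmetric])
qed

text \<open>The same majorant for all times, as required for continuity with time as the parameter.\<close>
lemma term_at_joint_estimates:
  assumes "r \<in> closed_segment s t"
  shows "cauchy_estimates \<rho> (\<lambda>z. \<bar>t - s\<bar> ^ k / fact k * power_sum (iter_coeff k) z) (term_at k r)"
proof (rule cauchy_estimates_mono[OF term_at_estimates(1)[OF assms]])
  fix z assume z: "0 \<le> z" "z < \<rho>"
  have "\<bar>r - s\<bar> \<le> \<bar>t - s\<bar>" using assms by (auto simp: closed_segment_eq_real_ivl split: if_splits)
  then show "volume k r * power_sum (iter_coeff k) z \<le> \<bar>t - s\<bar> ^ k / fact k * power_sum (iter_coeff k) z"
    using power_sum_nonneg[OF iter_coeff_majorant z]
    by (intro mult_right_mono divide_right_mono power_mono) auto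
qed

lemma term_at_derivative_continuous:
  assumes "\<And>x. norm x < \<rho> \<Longrightarrow> continuous_on (closed_segment s t) (\<lambda>r. term_at k r x)"
  shows "continuous_on (closed_segment s t \<times> {x. norm x < \<rho>} \<times> UNIV)
      (\<lambda>(r, x, y). frechet_derivative (term_at k r) (at x) y)"
  by (rule cauchy_estimates_parametric_continuous(2)[OF term_at_joint_estimates _ _ assms])
     (auto intro!: mult_left_mono divide_right_mono mult_nonneg_nonneg divide_nonneg_nonneg
        power_sum_nonneg[OF iter_coeff_majorant] power_sum_mono[OF iter_coeff_majorant])

text \<open>The derivative of the term of order \<open>k\<close> with respect to its final time, as shown in
  \<open>term_at_time_derivative\<close>.\<close>
definition time_rate :: "nat \<Rightarrow> real \<Rightarrow> 'a \<Rightarrow> real" where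
  "time_rate k r x = (case k of 0 \<Rightarrow> 0 | Suc j \<Rightarrow> lie (v r) (term_at j r) x)"

lemma time_rate_continuous:
  assumes "\<And>j x. j < k \<Longrightarrow> norm x < \<rho> \<Longrightarrow> continuous_on (closed_segment s t) (\<lambda>r. term_at j r x)"
  shows "continuous_on (closed_segment s t \<times> {x. norm x < \<rho>}) (\<lambda>(r, x). time_rate k r x)"
proof (cases k)
  case 0
  then show ?thesis by (simp add: time_rate_def)
next
  case (Suc j)
  have "continuous_on (closed_segment s t \<times> {x. norm x < \<rho>})
      (\<lambda>z. frechet_derivative (term_at j (fst z)) (at (snd z)) (v (fst z) (snd z)))"
    using v_cont
    by (intro continuous_on_compose2[OF term_at_derivative_continuous,
          of j _ "\<lambda>z. (fst z, snd z, v (fst z) (snd z))", simplified])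
       (use assms Suc in \<open>auto intro!: continuous_intros simp: case_prod_unfold\<close>)
  then show ?thesis by (simp add: time_rate_def Suc lie_def case_prod_unfold)
qed

lemma interval_integral_FTC2_segment:
  fixes f :: "real \<Rightarrow> real"
  assumes f: "continuous_on (closed_segment s t) f" and r: "r \<in> closed_segment s t"
  shows "((\<lambda>u. LBINT y=s..u. f y) has_real_derivative f r) (at r within closed_segment s t)"
proof -
  have "closed_segment s t = {min s t..max s t}" by (auto simp: closed_segment_eq_real_ivl)
  then show ?thesis
    using interval_integral_FTC2[of "min s t" s "max s t" f r] assms
    by (simp add: has_real_derivative_iff_has_vector_derivative)
qed

text \<open>
  Differentiability in time of the term of order \<open>k\<close> needs continuity in time of the integrand in
  \<open>term_at_Suc\<close>, that is, of the differential of the preceding term; this follows from the continuity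
  in time of that term itself, whence the induction.
\<close>
lemma term_at_time_derivative:
  assumes x: "norm x < \<rho>" and r: "r \<in> closed_segment s t"
  shows "((\<lambda>r. term_at k r x) has_real_derivative time_rate k r x) (at r within closed_segment s t)"
  using assms
proof (induction k arbitrary: x r rule: less_induct)
  case (less k)
  have cont: "continuous_on (closed_segment s t) (\<lambda>r. term_at j r x)" if "j < k" "norm x < \<rho>" for j x
    by (rule DERIV_continuous_on[OF less.IH[OF that]])
  show ?case
  proof (cases k)
    case 0
    then show ?thesis by (simp add: term_at_0 time_rate_def)
  next
    case (Suc j)
    have "continuous_on (closed_segment s t) (\<lambda>q. time_rate k q x)"
      by (rule continuous_on_compose2[OF time_rate_continuous, of k _ "\<lambda>q. (q, x)", simplified])
         (use cont less.prems in \<open>auto intro!: continuous_intros\<close>)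
    from interval_integral_FTC2_segment[OF this less.prems(2)]
    show ?thesis
      by (rule has_field_derivative_transform_within[OF _ zero_less_one less.prems(2)])
         (simp add: Suc time_rate_def term_at_Suc[OF _ less.prems(1)])
  qed
qed

lemma term_at_continuous:
  "norm x < \<rho> \<Longrightarrow> continuous_on (closed_segment s t) (\<lambda>r. term_at k r x)"
  by (rule DERIV_continuous_on[OF term_at_time_derivative])

lemma time_rate_jointly_continuous:
  "continuous_on (closed_segment s t \<times> {x. norm x < \<rho>}) (\<lambda>(r, x). time_rate k r x)"
  by (rule time_rate_continuous[OF term_at_continuous])

lemma term_at_derivative_jointly_continuous:
  "continuous_on (closed_segment s t \<times> {x. norm x < \<rho>} \<times> UNIV)
     (\<lambda>(r, x, y). frechet_derivative (term_at k r) (at x) y)"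
  by (rule term_at_derivative_continuous[OF term_at_continuous])

text \<open>
  The chain rule for partial derivatives, where joint continuity is known for the derivative in time.
  Time ranges over a closed interval, at whose endpoints the derivative is one-sided.
\<close>
lemma term_at_curve_derivative:
  assumes r: "r \<in> closed_segment s t" and x: "norm (\<phi> r) < \<rho>"
    and inside: "\<And>r. r \<in> closed_segment s t \<Longrightarrow> norm (\<phi> r) < \<rho>"
    and \<phi>: "(\<phi> has_vector_derivative y) (at r within closed_segment s t)"
  shows "((\<lambda>r. term_at k r (\<phi> r)) has_real_derivative
      time_rate k r (\<phi> r) + frechet_derivative (term_at k r) (at (\<phi> r)) y) (at r within closed_segment s t)"
proof -
  let ?S = "closed_segment s t" and ?B = "{x::'a. norm x < \<rho>}"
  let ?A = "frechet_derivative (term_at k r) (at (\<phi> r))"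
  have "term_at k r differentiable (at (\<phi> r))"
    using term_at_estimates(1)[OF r] x unfolding cauchy_estimates_def by blast
  then have A: "(term_at k r has_derivative ?A) (at (\<phi> r))"
    by (simp add: frechet_derivative_works)
  have "((\<lambda>(x, r). term_at k r x) has_derivative
      (\<lambda>(h, l). ?A h + blinfun_scaleR_left (time_rate k r (\<phi> r)) l)) (at (\<phi> r, r) within ?B \<times> ?S)"
  proof (rule has_derivative_partialsI[where f="\<lambda>x r. term_at k r x"
        and fy="\<lambda>x r. blinfun_scaleR_left (time_rate k r x)"])
    show "(term_at k r has_derivative ?A) (at (\<phi> r) within ?B)"
      using A by (rule has_derivative_at_withinI)
    show "((\<lambda>r. term_at k r x) has_derivative blinfun_apply (blinfun_scaleR_left (time_rate k r x)))
        (at r within ?S)" if "x \<in> ?B" "r \<in> ?S" for x r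
      using term_at_time_derivative[of x r k] that
      by (simp add: has_field_derivative_def mult.commute[of _ "time_rate k r x"])
    have "continuous_on (?B \<times> ?S) (\<lambda>z. time_rate k (snd z) (fst z))"
      by (rule continuous_on_compose2[OF time_rate_jointly_continuous,
            of _ "\<lambda>z. (snd z, fst z)", simplified])
         (auto intro!: continuous_intros)
    then have "continuous_on (?B \<times> ?S) (\<lambda>z. blinfun_scaleR_left (time_rate k (snd z) (fst z)))"
      by (rule bounded_linear.continuous_on[OF bounded_linear_blinfun_scaleR_left])
    then show "continuous (at (\<phi> r, r) within ?B \<times> ?S) (\<lambda>(x, r). blinfun_scaleR_left (time_rate k r x))"
      using r x by (auto simp: continuous_on_eq_continuous_within case_prod_unfold)
  qed (use r in auto)
  then have outer: "((\<lambda>(x, r). term_at k r x) has_derivative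
      (\<lambda>(h, l). ?A h + blinfun_scaleR_left (time_rate k r (\<phi> r)) l))
      (at (\<phi> r, r) within (\<lambda>r. (\<phi> r, r)) ` ?S)"
    by (rule has_derivative_subset) (use inside in auto)
  have inner: "((\<lambda>r. (\<phi> r, r)) has_derivative (\<lambda>l. (l *\<^sub>R y, l))) (at r within ?S)"
    using \<phi> unfolding has_vector_derivative_def by (intro has_derivative_Pair has_derivative_ident)
  have "((\<lambda>r. term_at k r (\<phi> r)) has_derivative (\<lambda>l. ?A (l *\<^sub>R y) + l * time_rate k r (\<phi> r))) (at r within ?S)"
    using has_derivative_in_compose[OF inner outer] by simp
  moreover have "(\<lambda>l. ?A (l *\<^sub>R y) + l * time_rate k r (\<phi> r)) = (*) (time_rate k r (\<phi> r) + ?A y)"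
    using linear_scale[OF has_derivative_linear[OF A]] by (simp add: fun_eq_iff algebra_simps)
  ultimately show ?thesis by (simp only: has_field_derivative_def)
qed

end

section \<open>The chronological exponential along a curve\<close>

text \<open>
  Summable bounds for the quadratic remainders replace continuity of the derivatives near \<open>x\<close> as a
  criterion for differentiation term by term.
\<close>
lemma has_derivative_suminf_quadratic:
  fixes h :: "nat \<Rightarrow> 'a::real_normed_vector \<Rightarrow> real"
  assumes d: "0 < d" and c: "summable c"
    and A: "\<And>k. linear (A k)" "\<And>k y. \<bar>A k y\<bar> \<le> c k * norm y"
    and rem: "\<And>k y. norm y \<le> d \<Longrightarrow> \<bar>h k (x + y) - h k x - A k y\<bar> \<le> c k * B * (norm y)\<^sup>2"
    and h: "\<And>y. norm y \<le> d \<Longrightarrow> summable (\<lambda>k. h k (x + y))"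
  shows "((\<lambda>x. \<Sum>k. h k x) has_derivative (\<lambda>y. \<Sum>k. A k y)) (at x)" and "\<And>y. summable (\<lambda>k. A k y)"
proof -
  show As: "summable (\<lambda>k. A k y)" for y
    by (rule summable_comparison_test[OF _ summable_mult2[OF c, of "norm y"]]) (use A(2) in auto)
  have h0: "summable (\<lambda>k. h k x)" using h[of 0] d by simp
  show "((\<lambda>x. \<Sum>k. h k x) has_derivative (\<lambda>y. \<Sum>k. A k y)) (at x)"
  proof (rule has_derivative_of_quadratic_remainder[OF _ _ d])
    show "linear (\<lambda>y. \<Sum>k. A k y)"
      by (rule linearI) (simp_all add: linear_add[OF A(1)] linear_scale[OF A(1)] suminf_add As suminf_mult)
    show "norm (\<Sum>k. A k y) \<le> (\<Sum>k. c k) * norm y" for y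
      unfolding suminf_mult2[OF c] by (rule norm_suminf_le) (use A(2) summable_mult2[OF c] in auto)
    fix y :: 'a assume y: "norm y \<le> d"
    have "(\<Sum>k. h k (x + y)) - (\<Sum>k. h k x) - (\<Sum>k. A k y) = (\<Sum>k. h k (x + y) - h k x - A k y)"
      by (simp add: suminf_diff h[OF y] h0 As summable_diff)
    moreover have "norm (\<Sum>k. h k (x + y) - h k x - A k y) \<le> (\<Sum>k. c k * B * (norm y)\<^sup>2)"
      by (rule norm_suminf_le) (use rem[OF y] summable_mult2[OF c] in \<open>auto simp: mult.assoc\<close>)
    moreover have "(\<Sum>k. c k * B * (norm y)\<^sup>2) = (\<Sum>k. c k) * B * (norm y)\<^sup>2"
      using suminf_mult2[OF c, of "B * (norm y)\<^sup>2"] by (simp add: mult.assoc)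
    ultimately show "norm ((\<Sum>k. h k (x + y)) - (\<Sum>k. h k x) - (\<Sum>k. A k y))
        \<le> (\<Sum>k. c k) * B * (norm y)\<^sup>2" by simp
  qed
qed

text \<open>
  The flow and its bounds enter only through the assumption on geometric decay in a neighbourhood of
  the curve that has the same size at all times.
\<close>
locale evolution_along_curve = majorized_evolution +
  fixes \<phi> \<phi>' :: "real \<Rightarrow> 'a" and \<delta> q K :: real
  assumes \<delta>: "0 < \<delta>" and q: "0 \<le> q" "q < 1"
    and inside: "\<And>r. r \<in> closed_segment s t \<Longrightarrow> norm (\<phi> r) + 2 * \<delta> < \<rho>"
    and geometric: "\<And>r k. r \<in> closed_segment s t \<Longrightarrow>
      volume k r * power_sum (iter_coeff k) (norm (\<phi> r) + 2 * \<delta>) \<le> K * q ^ k"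
    and \<phi>: "has_C1_derivative_on \<phi> \<phi>' (closed_segment s t)"
begin

lemma power_sum_geometric:
  assumes "r \<in> closed_segment s t" "0 \<le> z" "z \<le> norm (\<phi> r) + 2 * \<delta>"
  shows "volume k r * power_sum (iter_coeff k) z \<le> K * q ^ k"
proof -
  have "volume k r * power_sum (iter_coeff k) z \<le> volume k r * power_sum (iter_coeff k) (norm (\<phi> r) + 2 * \<delta>)"
    by (intro mult_left_mono power_sum_mono[OF iter_coeff_majorant] assms inside) auto
  then show ?thesis using geometric[OF assms(1), of k] by linarith
qed

lemma K_nonneg: "0 \<le> K"
proof -
  have "0 \<le> volume 0 s * power_sum (iter_coeff 0) (norm (\<phi> s) + 2 * \<delta>)"
    using \<delta> inside[of s] by (intro mult_nonneg_nonneg power_sum_nonneg[OF iter_coeff_majorant]) auto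
  then show ?thesis using geometric[of s 0] by simp
qed

lemma geometric_summable: "summable (\<lambda>k. c * q ^ k)"
  using q by (intro summable_mult summable_geometric) auto

lemma term_at_geometric:
  assumes "r \<in> closed_segment s t" "norm (x - \<phi> r) \<le> 2 * \<delta>"
  shows "\<bar>term_at k r x\<bar> \<le> K * q ^ k"
proof -
  have "norm x \<le> norm (\<phi> r) + 2 * \<delta>" using assms norm_triangle_sub[of x "\<phi> r"] by simp
  moreover have "norm x < \<rho>" using calculation inside[OF assms(1)] by simp
  then have "\<bar>term_at k r x\<bar> \<le> volume k r * power_sum (iter_coeff k) (norm x)"
    using term_at_estimates(1)[OF assms(1)] unfolding cauchy_estimates_def by blast
  ultimately show ?thesis using power_sum_geometric[OF assms(1), of "norm x" k] by simp
qed

lemma chron_exp_converges_near: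
  assumes "r \<in> closed_segment s t" "norm (x - \<phi> r) \<le> 2 * \<delta>"
  shows "chron_exp_converges v s r g x"
  unfolding chron_exp_converges_def
proof (intro conjI allI)
  have "norm x < \<rho>" using assms inside[OF assms(1)] norm_triangle_sub[of x "\<phi> r"] by simp
  then show "set_integrable (lborel_pow k) (time_simplex k s r) (\<lambda>\<tau>. lie_iter v \<tau> k g x)" for k
    by (rule lie_iter_set_integrable[OF assms(1)])
  show "summable (chron_term v s r g x)"
    by (rule summable_comparison_test[OF _ geometric_summable[of K]])
       (use term_at_geometric[OF assms] in auto)
qed

lemma term_at_derivative_geometric:
  assumes r: "r \<in> closed_segment s t"
  shows "\<bar>frechet_derivative (term_at k r) (at (\<phi> r)) y\<bar> \<le> K / \<delta> * q ^ k * norm y"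
proof -
  have "\<bar>frechet_derivative (term_at k r) (at (\<phi> r)) y\<bar>
      \<le> volume k r * power_sum (iter_coeff k) (norm (\<phi> r) + \<delta>) / \<delta> * norm y"
    using term_at_estimates(1)[OF r] \<delta> inside[OF r] unfolding cauchy_estimates_def by auto
  also have "\<dots> \<le> K * q ^ k / \<delta> * norm y"
    using \<delta> by (intro mult_right_mono divide_right_mono power_sum_geometric r) auto
  finally show ?thesis by simp
qed

lemma chron_exp_has_derivative:
  assumes r: "r \<in> closed_segment s t"
  shows "(chron_exp v s r g has_derivative (\<lambda>y. \<Sum>k. frechet_derivative (term_at k r) (at (\<phi> r)) y)) (at (\<phi> r))"
    and "\<And>y. summable (\<lambda>k. frechet_derivative (term_at k r) (at (\<phi> r)) y)"
proof -
  let ?A = "\<lambda>k. frechet_derivative (term_at k r) (at (\<phi> r))"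
  have lin: "linear (?A k)" for k
    using term_at_estimates(1)[OF r, of k] inside[OF r] \<delta>
    unfolding cauchy_estimates_def by (intro linear_frechet_derivative) auto
  have rem: "\<bar>term_at k r (\<phi> r + y) - term_at k r (\<phi> r) - ?A k y\<bar> \<le> K / \<delta> * q ^ k * (1 / \<delta>) * (norm y)\<^sup>2"
    if y: "norm y \<le> \<delta>" for k y
  proof -
    have "\<bar>term_at k r (\<phi> r + y) - term_at k r (\<phi> r) - ?A k y\<bar>
        \<le> volume k r * power_sum (iter_coeff k) (norm (\<phi> r) + \<delta>) * (norm y / \<delta>)\<^sup>2"
      using term_at_estimates(1)[OF r] \<delta> inside[OF r] y unfolding cauchy_estimates_def by auto
    also have "\<dots> \<le> K * q ^ k * (norm y / \<delta>)\<^sup>2"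
      using \<delta> by (intro mult_right_mono power_sum_geometric r) auto
    finally show ?thesis using \<delta> by (simp add: power2_eq_square field_simps)
  qed
  have sums: "summable (\<lambda>k. term_at k r (\<phi> r + y))" if "norm y \<le> \<delta>" for y
    by (rule summable_comparison_test[OF _ geometric_summable[of K]])
       (use term_at_geometric[OF r, of "\<phi> r + y"] that \<delta> in auto)
  note * = has_derivative_suminf_quadratic[OF \<delta> geometric_summable lin term_at_derivative_geometric[OF r] rem sums]
  show "(chron_exp v s r g has_derivative (\<lambda>y. \<Sum>k. ?A k y)) (at (\<phi> r))"
    using *(1) unfolding chron_exp_def[abs_def] .
  show "summable (\<lambda>k. ?A k y)" for y by (rule *(2))
qed

text \<open>
  Termwise differentiation with bounds uniform in time.  The time derivative of the term of order
  \<open>k + 1\<close> is the Lie derivative of the term of order \<open>k\<close>, so these derivatives sum to the Lie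
  derivative of the whole series.
\<close>
lemma chron_exp_along_curve_C1:
  "has_C1_derivative_on (\<lambda>r. chron_exp v s r g (\<phi> r))
     (\<lambda>r. lie (v r) (chron_exp v s r g) (\<phi> r) + frechet_derivative (chron_exp v s r g) (at (\<phi> r)) (\<phi>' r))
     (closed_segment s t)"
proof -
  let ?S = "closed_segment s t"
  let ?A = "\<lambda>k r. frechet_derivative (term_at k r) (at (\<phi> r))"
  define c where "c k r = time_rate k r (\<phi> r) + ?A k r (\<phi>' r)" for k r
  have \<phi>_cont: "continuous_on ?S \<phi>" and \<phi>'_cont: "continuous_on ?S \<phi>'"
    using \<phi> unfolding has_C1_derivative_on_def
    by (auto intro!: continuous_on_vector_derivative)
  have in_ball: "norm (\<phi> r) < \<rho>" if "r \<in> ?S" for r using inside[OF that] \<delta> by simp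
  have v_curve: "continuous_on ?S (\<lambda>r. v r (\<phi> r))"
    by (rule continuous_on_compose2[OF v_cont, of _ "\<lambda>r. (r, \<phi> r)", simplified])
       (use in_ball in \<open>auto intro!: continuous_intros \<phi>_cont\<close>)
  have bdd: "\<exists>b. \<forall>r\<in>?S. norm (f r) \<le> b" if "continuous_on ?S f" for f :: "real \<Rightarrow> 'a"
    using compact_imp_bounded[OF compact_continuous_image[OF that compact_segment]]
    by (auto simp: bounded_iff)
  obtain b1 where b1: "\<And>r. r \<in> ?S \<Longrightarrow> norm (v r (\<phi> r)) \<le> b1" using bdd[OF v_curve] by blast
  obtain b2 where b2: "\<And>r. r \<in> ?S \<Longrightarrow> norm (\<phi>' r) \<le> b2" using bdd[OF \<phi>'_cont] by blast
  \<comment> \<open>The two parts bound the derivative in time and the derivative in the direction of the curve.\<close>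
  define N where "N k = (case k of 0 \<Rightarrow> 0 | Suc j \<Rightarrow> K / \<delta> * b1 * q ^ j) + K / \<delta> * b2 * q ^ k" for k
  have N: "summable N"
    unfolding N_def by (intro summable_add geometric_summable, subst summable_Suc_iff[symmetric])
      (use q in \<open>simp add: summable_geometric\<close>)
  have A_le: "\<bar>?A k r y\<bar> \<le> K / \<delta> * b * q ^ k" if "r \<in> ?S" "norm y \<le> b" for k r y b
  proof -
    have "K / \<delta> * q ^ k * norm y \<le> K / \<delta> * q ^ k * b"
      using that K_nonneg q \<delta> by (intro mult_left_mono) auto
    then show ?thesis using term_at_derivative_geometric[OF that(1), of k y] by (simp add: mult_ac)
  qed
  have c_le: "norm (c k r) \<le> N k" if r: "r \<in> ?S" for k r
  proof -
    have "\<bar>time_rate k r (\<phi> r)\<bar> \<le> (case k of 0 \<Rightarrow> 0 | Suc j \<Rightarrow> K / \<delta> * b1 * q ^ j)"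
      using A_le[OF r b1[OF r]] by (auto simp: time_rate_def lie_def split: nat.split)
    then show ?thesis unfolding c_def N_def using A_le[OF r b2[OF r], of k] by simp
  qed
  have unif: "uniform_limit ?S (\<lambda>n r. \<Sum>i<n. c i r) (\<lambda>r. \<Sum>k. c k r) sequentially"
    by (rule Weierstrass_m_test[OF c_le N])
  have sum_c: "(\<Sum>k. c k r) = lie (v r) (chron_exp v s r g) (\<phi> r)
      + frechet_derivative (chron_exp v s r g) (at (\<phi> r)) (\<phi>' r)" if r: "r \<in> ?S" for r
  proof -
    note D = frechet_derivative_at[OF chron_exp_has_derivative(1)[OF r], symmetric]
    note As = chron_exp_has_derivative(2)[OF r]
    have "(\<lambda>k. time_rate (Suc k) r (\<phi> r)) sums (\<Sum>k. ?A k r (v r (\<phi> r)))"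
      using summable_sums[OF As[of "v r (\<phi> r)"]] by (simp add: time_rate_def lie_def)
    then have "(\<lambda>k. time_rate k r (\<phi> r)) sums (\<Sum>k. ?A k r (v r (\<phi> r)))"
      by (subst (asm) sums_Suc_iff) (simp add: time_rate_def)
    from sums_add[OF this summable_sums[OF As[of "\<phi>' r"]]]
    show ?thesis unfolding c_def lie_def D by (rule sums_unique[symmetric])
  qed
  have c_cont: "continuous_on ?S (c k)" for k
  proof -
    have "continuous_on ?S (\<lambda>r. time_rate k r (\<phi> r))"
      by (rule continuous_on_compose2[OF time_rate_jointly_continuous,
            of _ "\<lambda>r. (r, \<phi> r)", simplified])
         (use in_ball in \<open>auto intro!: continuous_intros \<phi>_cont\<close>)
    moreover have "continuous_on ?S (\<lambda>r. ?A k r (\<phi>' r))"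
      by (rule continuous_on_compose2[OF term_at_derivative_jointly_continuous,
            of _ "\<lambda>r. (r, \<phi> r, \<phi>' r)", simplified])
         (use in_ball in \<open>auto intro!: continuous_intros \<phi>_cont \<phi>'_cont\<close>)
    ultimately show ?thesis unfolding c_def by (rule continuous_on_add)
  qed
  have "continuous_on ?S (\<lambda>r. \<Sum>k. c k r)"
    by (rule uniform_limit_theorem[OF _ unif]) (auto intro!: always_eventually continuous_on_sum c_cont)
  moreover have "\<exists>G. \<forall>r\<in>?S. (\<lambda>k. term_at k r (\<phi> r)) sums G r \<and>
      (G has_real_derivative (\<Sum>k. c k r)) (at r within ?S)"
  proof (rule has_field_derivative_series[OF convex_closed_segment _ unif ends_in_segment(1)])
    show "((\<lambda>r. term_at k r (\<phi> r)) has_real_derivative c k r) (at r within ?S)" if r: "r \<in> ?S" for k r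
      unfolding c_def using \<phi> r unfolding has_C1_derivative_on_def
      by (intro term_at_curve_derivative in_ball) auto
    show "summable (\<lambda>k. term_at k s (\<phi> s))"
      using chron_exp_converges_near[of s "\<phi> s"] \<delta> unfolding chron_exp_converges_def by simp
  qed
  then obtain G where G: "\<And>r. r \<in> ?S \<Longrightarrow> (\<lambda>k. term_at k r (\<phi> r)) sums G r"
    "\<And>r. r \<in> ?S \<Longrightarrow> (G has_real_derivative (\<Sum>k. c k r)) (at r within ?S)" by blast
  have "((\<lambda>r. chron_exp v s r g (\<phi> r)) has_vector_derivative (\<Sum>k. c k r)) (at r within ?S)"
    if r: "r \<in> ?S" for r
  proof (rule has_vector_derivative_transform[OF r])
    show "chron_exp v s r g (\<phi> r) = G r" if "r \<in> ?S" for r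
      unfolding chron_exp_def by (rule sums_unique[OF G(1)[OF that], symmetric])
    show "(G has_vector_derivative (\<Sum>k. c k r)) (at r within ?S)"
      using G(2)[OF r] by (simp add: has_real_derivative_iff_has_vector_derivative)
  qed
  ultimately show ?thesis
    unfolding has_C1_derivative_on_def by (simp add: sum_c cong: continuous_on_cong)
qed

end

section \<open>Formal series with finite norm\<close>

text \<open>
  The strict inequality leaves room for a form whose norm exceeds the infimum that defines the tensor
  norm.
\<close>
lemma hom_poly_bounded_multilinear:
  assumes "f \<in> hom_poly p" "tensor_norm p f < C"
  obtains F where "bounded_multilinear p F C" "\<And>x. f x = F (replicate p x)"
proof -
  have ne: "{C. \<exists>F. is_tensor_form p f F \<and> tensor_bound p F C} \<noteq> {}"
    using assms(1) by (auto simp: hom_poly_def)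
  obtain D F where D: "D < C" and F: "is_tensor_form p f F" "tensor_bound p F D"
    using cInf_lessD[OF ne assms(2)[unfolded tensor_norm_def]] by blast
  have "bounded_multilinear p F C"
    unfolding bounded_multilinear_def tensor_bound_def
  proof (intro conjI allI impI)
    fix us ws :: "'a list" assume "length us + length ws + 1 = p"
    then show "linear (\<lambda>x. F (us @ x # ws))"
      using F(1)[unfolded is_tensor_form_def sym_multilinear_def, THEN conjunct1, THEN conjunct1,
          rule_format, of "us @ 0 # ws" "length us"]
      by (simp add: list_update_length)
  next
    show "0 \<le> C" using F(2) D by (auto simp: tensor_bound_def)
  next
    fix xs :: "'a list" assume "length xs = p"
    then have "norm (F xs) \<le> D * prod_list (map norm xs)" using F(2) by (auto simp: tensor_bound_def)
    also have "\<dots> \<le> C * prod_list (map norm xs)"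
      using D by (intro mult_right_mono prod_list_nonneg) auto
    finally show "norm (F xs) \<le> C * prod_list (map norm xs)" .
  qed
  then show thesis using that F(1) by (auto simp: is_tensor_form_def)
qed

lemma majorized_series_eval:
  fixes f :: "nat \<Rightarrow> 'a::real_normed_vector \<Rightarrow> 'b::banach"
  assumes m: "majorant \<rho> m" and f: "\<And>p. f p \<in> hom_poly p" "\<And>p. tensor_norm p (f p) < m p"
  shows "majorized \<rho> m (series_eval f)"
proof -
  have "\<exists>F. bounded_multilinear p F (m p) \<and> (\<forall>x. f p x = F (replicate p x))" for p
    by (rule hom_poly_bounded_multilinear[OF f]) blast
  then obtain F where F: "\<And>p. bounded_multilinear p (F p) (m p)" "\<And>p x. f p x = F p (replicate p x)"
    by metis
  have "(\<lambda>p. F p (replicate p x)) sums series_eval f x" if x: "norm x < \<rho>" for x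
    unfolding series_eval_def F(2)
    by (rule summable_sums, rule summable_comparison_test[OF _ majorant_summable[OF m norm_ge_zero x]])
       (use bounded_multilinear_replicate_le[OF F(1)] in auto)
  then show ?thesis unfolding majorized_def using F(1) by blast
qed

lemma tensor_norm_nonneg: "f \<in> hom_poly p \<Longrightarrow> 0 \<le> tensor_norm p f"
  unfolding tensor_norm_def by (rule cInf_greatest) (auto simp: hom_poly_def tensor_bound_def)

lemma coefficient_le_tensor_norm:
  assumes "power_series X p \<in> hom_poly p"
  shows "X p \<le> tensor_norm p (power_series X p)"
  unfolding tensor_norm_def
proof (rule cInf_greatest)
  show "{C. \<exists>F. is_tensor_form p (power_series X p) F \<and> tensor_bound p F C} \<noteq> {}"
    using assms by (auto simp: hom_poly_def)
  fix C assume "C \<in> {C. \<exists>F. is_tensor_form p (power_series X p) F \<and> tensor_bound p F C}"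
  then obtain F where "is_tensor_form p (power_series X p) F" and bound: "tensor_bound p F C"
    by blast
  then have F: "power_series X p 1 = F (replicate p 1)" by (simp add: is_tensor_form_def)
  from bound have "norm (F (replicate p 1)) \<le> C * prod_list (map norm (replicate p (1::real)))"
    unfolding tensor_bound_def by (metis length_replicate)
  then show "X p \<le> C" using F by (simp add: power_series_def map_replicate prod_list_replicate)
qed

lemma summable_power_mono:
  fixes a :: "nat \<Rightarrow> real"
  assumes "summable (\<lambda>p. a p * \<rho> ^ p)" "\<And>p. 0 \<le> a p" "0 \<le> z" "z \<le> \<rho>"
  shows "summable (\<lambda>p. a p * z ^ p)"
  by (rule summable_comparison_test[OF _ assms(1)])
     (use assms in \<open>auto intro!: mult_left_mono power_mono\<close>)

lemma series_space_hom_poly: "f \<in> series_space r \<Longrightarrow> f p \<in> hom_poly p"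
  by (simp add: series_space_def)

lemma ext_series_space_hom_poly:
  assumes "f \<in> ext_series_space r"
  shows "f p \<in> hom_poly p"
proof (cases "r = \<infinity>")
  case True
  then have "f \<in> series_space 1" using assms by (simp add: ext_series_space_def)
  then show ?thesis by (rule series_space_hom_poly)
qed (use assms in \<open>auto simp: ext_series_space_def intro: series_space_hom_poly\<close>)

lemma ext_series_space_summable:
  assumes f: "f \<in> ext_series_space r" and z: "0 \<le> z" "ereal z < r"
  shows "summable (\<lambda>p. tensor_norm p (f p) * z ^ p)"
proof (cases r)
  case (real r')
  then have "summable (\<lambda>p. tensor_norm p (f p) * r' ^ p)"
    using f by (simp add: ext_series_space_def series_space_def)
  then show ?thesis
    by (rule summable_power_mono)
       (use z real tensor_norm_nonneg[OF ext_series_space_hom_poly[OF f]] in auto)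
next
  case PInf
  then have "f \<in> series_space (z + 1)" using f z by (simp add: ext_series_space_def)
  then have "summable (\<lambda>p. tensor_norm p (f p) * (z + 1) ^ p)" by (simp add: series_space_def)
  then show ?thesis
    by (rule summable_power_mono)
       (use z tensor_norm_nonneg[OF ext_series_space_hom_poly[OF f]] in auto)
qed (use z in auto)

text \<open>
  A summable positive correction makes the coefficients strictly larger than the tensor norms; the
  choice \<open>(1 / (2 \<rho>))\<^sup>p\<close> adds a geometric series of ratio at most \<open>1 / 2\<close> on the disc of radius \<open>\<rho>\<close>.
\<close>
lemma series_space_majorant:
  fixes f :: "nat \<Rightarrow> 'a::real_normed_vector \<Rightarrow> 'b::banach"
  assumes f: "f \<in> series_space \<rho>" and \<rho>: "0 < \<rho>"
  obtains m where "majorant \<rho> m" "majorized \<rho> m (series_eval f)"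
proof -
  define m where "m p = tensor_norm p (f p) + (1 / (2 * \<rho>)) ^ p" for p
  note hp = series_space_hom_poly[OF f]
  have "summable (\<lambda>p. tensor_norm p (f p) * \<rho> ^ p + (1 / 2 :: real) ^ p)"
    using f by (intro summable_add summable_geometric) (auto simp: series_space_def)
  then have "summable (\<lambda>p. m p * \<rho> ^ p)"
    using \<rho> by (simp add: m_def distrib_right power_mult_distrib[symmetric])
  moreover have "0 \<le> m p" for p using tensor_norm_nonneg[OF hp] \<rho> by (simp add: m_def)
  ultimately have "majorant \<rho> m"
    unfolding majorant_def using summable_power_mono by (metis less_imp_le)
  moreover have "tensor_norm p (f p) < m p" for p using \<rho> by (simp add: m_def)
  ultimately show thesis using that majorized_series_eval[OF _ hp] by blast
qed

theorem theorem6p1: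
  fixes r0 :: ereal and I :: "real set"
    and V :: "real \<Rightarrow> nat \<Rightarrow> 'a::banach \<Rightarrow> 'a"
    and X :: "nat \<Rightarrow> real"
    and R Rbar :: real
    and f :: "nat \<Rightarrow> 'a \<Rightarrow> real"
    and t1 t2 :: real
    and \<gamma> :: "real \<Rightarrow> real"
    and \<phi> \<phi>' :: "real \<Rightarrow> 'a"
  defines "v \<equiv> (\<lambda>t. series_eval (V t))"
  defines "U \<equiv> (\<lambda>t. chron_exp v t1 t (series_eval f))"
  assumes "0 < r0" and "is_interval I"
    and "\<And>t. t \<in> I \<Longrightarrow> V t \<in> ext_series_space r0"
    and "normal_family r0 I V"
    and "power_series X \<in> ext_series_space r0"
    and "\<And>t p. t \<in> I \<Longrightarrow> 0 \<le> tensor_norm p (V t p) \<and> tensor_norm p (V t p) \<le> X p"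
    and "continuous_on (I \<times> ext_ball r0) (\<lambda>(t, x). v t x)"
    and "0 < R" and "R < Rbar" and "ereal Rbar < r0"
    and "f \<in> series_space Rbar"
    and "t1 \<in> I" and "t2 \<in> I"
    and "backward_flow r0 (series_eval (power_series X)) R \<bar>t2 - t1\<bar> \<gamma>"
    and "\<gamma> \<bar>t2 - t1\<bar> > 0"
    and "has_C1_derivative_on \<phi> \<phi>' (closed_segment t1 t2)"
    and "\<And>t. t \<in> closed_segment t1 t2 \<Longrightarrow> norm (\<phi> t) \<le> \<gamma> \<bar>t - t1\<bar>"
  shows "(\<forall>t\<in>closed_segment t1 t2.
            (\<forall>\<^sub>F x in nhds (\<phi> t). chron_exp_converges v t1 t (series_eval f) x) \<and>
            U t differentiable (at (\<phi> t))) \<and>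
         has_C1_derivative_on (\<lambda>t. U t (\<phi> t))
           (\<lambda>t. lie (v t) (U t) (\<phi> t) + frechet_derivative (U t) (at (\<phi> t)) (\<phi>' t))
           (closed_segment t1 t2)"
proof -
  let ?g = "series_eval f" and ?S = "closed_segment t1 t2" and ?T = "\<bar>t2 - t1\<bar>"
  note r0 = \<open>0 < R\<close> \<open>R < Rbar\<close> \<open>ereal Rbar < r0\<close>
  note X_space = \<open>power_series X \<in> ext_series_space r0\<close>
  have V_space: "V t \<in> ext_series_space r0" if "t \<in> I" for t using that by fact
  have V_le: "0 \<le> tensor_norm p (V t p) \<and> tensor_norm p (V t p) \<le> X p" if "t \<in> I" for t p
    using that by fact
  have flow: "\<gamma> 0 = R" "\<And>r. r \<in> {0..?T} \<Longrightarrow> \<gamma> r \<in> ext_ball r0"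
    "\<And>r. r \<in> {0..?T} \<Longrightarrow> (\<gamma> has_real_derivative - power_sum X (\<gamma> r)) (at r within {0..?T})"
    using \<open>backward_flow r0 (series_eval (power_series X)) R \<bar>t2 - t1\<bar> \<gamma>\<close>
    by (auto simp: backward_flow_def series_eval_def power_series_def power_sum_def)
  have \<phi>_le: "norm (\<phi> t) \<le> \<gamma> \<bar>t - t1\<bar>" if "t \<in> ?S" for t using that by fact
  have S_I: "?S \<subseteq> I"
    using \<open>is_interval I\<close> \<open>t1 \<in> I\<close> \<open>t2 \<in> I\<close> by (intro closed_segment_subset is_interval_convex)
  have X_nonneg: "0 \<le> X p" for p using V_le[OF \<open>t1 \<in> I\<close>, of p] by linarith
  have X_sum: "summable (\<lambda>p. X p * z ^ p)" if "0 \<le> z" "ereal z < r0" for z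
    by (rule summable_comparison_test[OF _ ext_series_space_summable[OF X_space that]])
       (use X_nonneg coefficient_le_tensor_norm[OF ext_series_space_hom_poly[OF X_space]] that in
         \<open>auto intro!: mult_right_mono\<close>)
  have X: "majorant Rbar X"
    unfolding majorant_def using X_nonneg X_sum less_trans[OF _ r0(3), of "ereal _"] by auto
  have X_pos: "0 \<le> power_sum X (\<gamma> r)" if "r \<in> {0..?T}" "0 \<le> \<gamma> r" for r
    unfolding power_sum_def using flow(2)[OF that(1)] that X_nonneg
    by (intro suminf_nonneg X_sum) (auto simp: ext_ball_def)
  obtain \<delta> q Y where \<delta>: "0 < \<delta>" and q: "0 \<le> q" "q < 1" and Y: "majorant Rbar Y" and XY: "\<And>p. X p < Y p"
    and below: "\<And>r. r \<in> {0..?T} \<Longrightarrow> 0 < \<gamma> r \<and> \<gamma> r + 2 * \<delta> < Rbar"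
    and decay: "\<And>m. majorant Rbar m \<Longrightarrow> \<exists>K. \<forall>r\<in>{0..?T}. \<forall>k.
       r ^ k / fact k * power_sum ((lie_coeff Y ^^ k) m) (\<gamma> r + 2 * \<delta>) \<le> K * q ^ k"
    using perturbed_flow_geometric_bound[OF X r0(1,2) abs_ge_zero flow(1) \<open>\<gamma> \<bar>t2 - t1\<bar> > 0\<close> flow(3) X_pos]
    by blast
  obtain m where m: "majorant Rbar m" "majorized Rbar m ?g"
    using series_space_majorant[OF \<open>f \<in> series_space Rbar\<close>] r0 by auto
  obtain K where K: "\<And>r k. r \<in> {0..?T} \<Longrightarrow>
      r ^ k / fact k * power_sum ((lie_coeff Y ^^ k) m) (\<gamma> r + 2 * \<delta>) \<le> K * q ^ k"
    using decay[OF m(1)] by blast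
  have dist: "\<bar>r - t1\<bar> \<in> {0..?T}" if "r \<in> ?S" for r
    using that by (auto simp: closed_segment_eq_real_ivl split: if_splits)
  interpret majorized_evolution v ?g Rbar Y m t1 t2
  proof
    show "majorized Rbar Y (v r)" if "r \<in> ?S" for r
      unfolding v_def
      by (rule majorized_series_eval[OF Y ext_series_space_hom_poly[OF V_space] le_less_trans[OF conjunct2[OF V_le] XY]])
         (use that S_I in auto)
    show "continuous_on (?S \<times> {x. norm x < Rbar}) (\<lambda>(r, x). v r x)"
      by (rule continuous_on_subset[OF \<open>continuous_on (I \<times> ext_ball r0) (\<lambda>(t, x). v t x)\<close>])
         (use S_I r0(3) in \<open>auto simp: ext_ball_def intro: less_trans[of "ereal _" "ereal Rbar"]\<close>)
  qed (use Y m in auto)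
  interpret evolution_along_curve v ?g Rbar Y m t1 t2 \<phi> \<phi>' \<delta> q K
  proof
    fix r k assume r: "r \<in> ?S"
    show in_ball: "norm (\<phi> r) + 2 * \<delta> < Rbar"
      using \<phi>_le[OF r] below[OF dist[OF r]] by linarith
    have "power_sum (iter_coeff k) (norm (\<phi> r) + 2 * \<delta>) \<le> power_sum (iter_coeff k) (\<gamma> \<bar>r - t1\<bar> + 2 * \<delta>)"
      using \<phi>_le[OF r] below[OF dist[OF r]] \<delta> by (intro power_sum_mono[OF iter_coeff_majorant]) auto
    then have "volume k r * power_sum (iter_coeff k) (norm (\<phi> r) + 2 * \<delta>)
        \<le> volume k r * power_sum (iter_coeff k) (\<gamma> \<bar>r - t1\<bar> + 2 * \<delta>)"
      by (intro mult_left_mono) auto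
    also have "\<dots> \<le> K * q ^ k" using K[OF dist[OF r], of k] by (simp add: iter_coeff_def)
    finally show "volume k r * power_sum (iter_coeff k) (norm (\<phi> r) + 2 * \<delta>) \<le> K * q ^ k" .
  qed (use \<delta> q \<open>has_C1_derivative_on \<phi> \<phi>' (closed_segment t1 t2)\<close> in auto)
  show ?thesis
  proof (intro conjI ballI)
    fix t assume t: "t \<in> ?S"
    show "\<forall>\<^sub>F x in nhds (\<phi> t). chron_exp_converges v t1 t ?g x"
      unfolding eventually_nhds_metric using \<delta> chron_exp_converges_near[OF t]
      by (intro exI[of _ \<delta>]) (auto simp: dist_norm)
    show "U t differentiable (at (\<phi> t))"
      unfolding U_def using chron_exp_has_derivative(1)[OF t] by (rule differentiableI)
  next
    show "has_C1_derivative_on (\<lambda>t. U t (\<phi> t))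
        (\<lambda>t. lie (v t) (U t) (\<phi> t) + frechet_derivative (U t) (at (\<phi> t)) (\<phi>' t)) ?S"
      unfolding U_def by (rule chron_exp_along_curve_C1)
  qed
qed

end
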